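(* Let $n>2k\ge 6$. Let $(S_l,T_l)$, $l\in[m]$, be all resistant pairs, indexed so that $T_0\prec T_1\prec\dots\prec T_m$ strictly, where $T_0=[2,n]$ and $S_0=\{1,n\}$. Then $$|\mathcal L(S_{l-1},k-1)|+|\mathcal L(T_{l-1},k)|>|\mathcal L(S_l,k-1)|+|\mathcal L(T_l,k)|\quad\text{for each } l\in[m],$$ and any cross-intersecting pair $\mathcal A\subset\binom{[2,n]}{k-1}$, $\mathcal B\subset\binom{[2,n]}{k}$ with $|\mathcal L(T_{l-1},k)|<|\mathcal B|\le|\mathcal L(T_l,k)|$ satisfies $|\mathcal A|+|\mathcal B|\le|\mathcal L(S_l,k-1)|+|\mathcal L(T_l,k)|$. Equivalently, if $\mathcal F\subset\binom{[n]}{k}$ is intersecting and $|\mathcal L(T_{l-1},k)|<\gamma(\mathcal F)\le|\mathcal L(T_l,k)|$, then $|\mathcal F|\le|\mathcal L(S_l,k-1)|+|\mathcal L(T_l,k)|$.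
   Context: $[a,b]=\{a,\dots,b\}$. On subsets of $[2,n]$ define the order $A\prec B$ iff $A\supseteq B$ or the minimal element of $A\setminus B$ is smaller than the minimal element of $B\setminus A$. For $S\subset[n]$ and an integer $a$, $\mathcal L(S,a)=\{A\in\binom{[2,n]}{a}: A\prec S\cap[2,n]\}$; $S$ is called its characteristic set. Families $\mathcal A,\mathcal B$ are cross-intersecting if $A\cap B\ne\emptyset$ for all $A\in\mathcal A,B\in\mathcal B$. A family is intersecting if any two sets intersect; $\gamma(\mathcal F)=|\mathcal F|-\Delta(\mathcal F)$, $\Delta$ the maximal degree. Sets $S\subset[n]$, $T\subset[2,n]$ form a resistant pair if either $T=\{2,3,4\}$ and $S=\{1,4\}$, or, with $j$ the largest element of $T$: (1) $S\cap T=\{j\}$, $S\cup T=[j]$, $|S|\le k$, $|T|\le k$; and (2) for each $i\ge 4$, $|[i]\cap S|<|[i]\setminus S|$. *)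

theory Defs
  imports "HOL-Library.Ramsey"
begin

(* The order on finite subsets of {2..n}. The minimum of the empty set is read as
   infinity: if A - B is empty then only the first disjunct can hold, and if B - A is
   empty then it does hold. The guard keeps Min away from the empty set. *)
definition lex_prec :: "nat set \<Rightarrow> nat set \<Rightarrow> bool" where
  "lex_prec A B \<longleftrightarrow> B \<subseteq> A \<or> (A - B \<noteq> {} \<and> B - A \<noteq> {} \<and> Min (A - B) < Min (B - A))"

definition lex_family :: "nat \<Rightarrow> nat set \<Rightarrow> nat \<Rightarrow> nat set set" where
  "lex_family n S a = {A \<in> nsets {2..n} a. lex_prec A (S \<inter> {2..n})}"

definition cross_intersecting :: "'a set set \<Rightarrow> 'a set set \<Rightarrow> bool" where
  "cross_intersecting \<A> \<B> \<longleftrightarrow> (\<forall>A\<in>\<A>. \<forall>B\<in>\<B>. A \<inter> B \<noteq> {})"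

definition intersecting :: "'a set set \<Rightarrow> bool" where
  "intersecting \<F> \<longleftrightarrow> (\<forall>A\<in>\<F>. \<forall>B\<in>\<F>. A \<inter> B \<noteq> {})"

definition max_degree :: "nat \<Rightarrow> nat set set \<Rightarrow> nat" where
  "max_degree n \<F> = Max ((\<lambda>x. card {F \<in> \<F>. x \<in> F}) ` {1..n})"

(* For finite \<F> and n \<ge> 1 the subtraction does not truncate. *)
definition diversity :: "nat \<Rightarrow> nat set set \<Rightarrow> nat" where
  "diversity n \<F> = card \<F> - max_degree n \<F>"

definition resistant_pair :: "nat \<Rightarrow> nat \<Rightarrow> nat set \<Rightarrow> nat set \<Rightarrow> bool" where
  "resistant_pair n k S T \<longleftrightarrow>
     S \<subseteq> {1..n} \<and> T \<subseteq> {2..n} \<and>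
     ((T = {2, 3, 4} \<and> S = {1, 4}) \<or>
      (T \<noteq> {} \<and>
       S \<inter> T = {Max T} \<and> S \<union> T = {1..Max T} \<and> card S \<le> k \<and> card T \<le> k \<and>
       (\<forall>i\<ge>4. card ({1..i} \<inter> S) < card ({1..i} - S))))"

end

(* Encode a subset X of {2..n} by v X = (\<Sum>x\<in>X. 2^(n - x)); then A precedes B iff v B <= v A, and the
   sets with a given trace on {..i} fill a dyadic interval of values. For a threshold c put
   A_c = {A. v (complement of A) < c} and B_c = {B. c <= v B}; these are cross-intersecting, and
   the lex families of a resistant pair (S, T) are A_c and B_c with c = v T. Simultaneous
   UV-compressions (a Kruskal-Katona argument in Hilton's form) reduce an arbitrary
   cross-intersecting pair to lex initial segments, hence to |A_c| + |B_c| with c the value of a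
   k-set.

   It remains to follow g(c) = |A_c| + |B_c| as c decreases. Crossing the dyadic interval with
   trace P on {..i} adds (n-i choose k-|P|) sets and removes (n-i choose n-k-|P|). If
   i < 2 |P| this is a loss; if i = 2 |P| the total is unchanged, and since the inclusion graph
   between complementary levels is regular, the value at the end of the interval dominates every
   value inside. Splitting intervals recursively, starting from the trace {2,3,4} on {..4}, the
   record values are exactly those of the resistant sets, and they strictly decrease. *)
theory Submission
  imports Defs
begin

section \<open>Binary values of sets, traces and dyadic intervals\<close>

section \<open>The lexicographic order as a numerical order\<close>

text \<open>Smaller elements are the more significant binary digits. Truncated subtraction would
  give elements above \<open>n\<close> the same weight 1 as \<open>n\<close>, hence the later
  restriction to subsets of \<open>{..n}\<close>.\<close>

definition lexval :: "nat \<Rightarrow> nat set \<Rightarrow> nat" where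
  "lexval n X = (\<Sum>x\<in>X. 2 ^ (n - x))"

lemma lexval_Un_disjoint:
  "finite X \<Longrightarrow> finite Y \<Longrightarrow> X \<inter> Y = {} \<Longrightarrow> lexval n (X \<union> Y) = lexval n X + lexval n Y"
  by (simp add: lexval_def sum.union_disjoint)

lemma lexval_mono: "finite Y \<Longrightarrow> X \<subseteq> Y \<Longrightarrow> lexval n X \<le> lexval n Y"
  unfolding lexval_def by (rule sum_mono2) auto

text \<open>Geometric sum: all elements beyond \<open>m\<close> together weigh one less than
  \<open>m\<close> itself.\<close>

lemma lexval_tail: "m \<le> n \<Longrightarrow> lexval n {Suc m..n} + 1 = 2 ^ (n - m)"
proof (induction "n - m" arbitrary: m)
  case 0
  then show ?case by (simp add: lexval_def)
next
  case (Suc d)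
  then have "m < n" and IH: "lexval n {Suc (Suc m)..n} + 1 = 2 ^ (n - Suc m)"
    by auto
  then have "{Suc m..n} = {Suc m} \<union> {Suc (Suc m)..n}"
    by auto
  then have "lexval n {Suc m..n} = 2 ^ (n - Suc m) + lexval n {Suc (Suc m)..n}"
    by (simp add: lexval_def)
  moreover have "2 ^ (n - m) = 2 * (2::nat) ^ (n - Suc m)"
    using \<open>m < n\<close> by (metis Suc_diff_Suc power_Suc)
  ultimately show ?case
    using IH by simp
qed

lemma lexval_split:
  assumes "X \<subseteq> {..n}"
  shows "lexval n X = lexval n (X \<inter> {..i}) + lexval n (X \<inter> {Suc i..n})"
proof -
  have fin: "finite X"
    using assms finite_subset by blast
  have "X = (X \<inter> {..i}) \<union> (X \<inter> {Suc i..n})"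
    using assms by auto
  then have "lexval n X = lexval n ((X \<inter> {..i}) \<union> (X \<inter> {Suc i..n}))"
    by simp
  also have "\<dots> = lexval n (X \<inter> {..i}) + lexval n (X \<inter> {Suc i..n})"
    by (rule lexval_Un_disjoint) (use fin in auto)
  finally show ?thesis .
qed

text \<open>The weight of \<open>m\<close> exceeds that of all later elements of \<open>Y\<close>.
  One inclusion below \<open>m\<close> is enough, as further elements of \<open>X\<close> only raise
  its value.\<close>

lemma lexval_less:
  assumes X: "X \<subseteq> {..n}" and Y: "Y \<subseteq> {..n}" and m: "m \<in> X" "m \<notin> Y"
    and below: "\<And>y. y < m \<Longrightarrow> y \<in> Y \<Longrightarrow> y \<in> X"
  shows "lexval n Y < lexval n X"
proof -
  have "m \<le> n" and fin: "finite X" "finite Y"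
    using X Y m finite_subset by auto
  have "lexval n Y = lexval n (Y \<inter> {..m}) + lexval n (Y \<inter> {Suc m..n})"
    using Y by (rule lexval_split)
  also have "Y \<inter> {..m} = Y \<inter> {..<m}"
    using m by (auto simp: le_less)
  also have "lexval n (Y \<inter> {Suc m..n}) \<le> lexval n {Suc m..n}"
    by (rule lexval_mono) auto
  also have "\<dots> < 2 ^ (n - m)"
    using lexval_tail[OF \<open>m \<le> n\<close>] by simp
  also have "lexval n (Y \<inter> {..<m}) + 2 ^ (n - m) = lexval n ((Y \<inter> {..<m}) \<union> {m})"
    using fin by (subst lexval_Un_disjoint) (auto simp: lexval_def)
  also have "\<dots> \<le> lexval n X"
    by (rule lexval_mono) (use fin m below in auto)
  finally show ?thesis by simp
qed

lemma first_difference: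
  fixes X Y :: "nat set"
  assumes "X \<noteq> Y"
  obtains m where "m \<in> X" "m \<notin> Y" "\<And>y. y < m \<Longrightarrow> y \<in> X \<longleftrightarrow> y \<in> Y"
  | m where "m \<in> Y" "m \<notin> X" "\<And>y. y < m \<Longrightarrow> y \<in> X \<longleftrightarrow> y \<in> Y"
proof -
  define m where "m = (LEAST y. (y \<in> X) \<noteq> (y \<in> Y))"
  have "\<exists>y. (y \<in> X) \<noteq> (y \<in> Y)"
    using assms by blast
  then have "(m \<in> X) \<noteq> (m \<in> Y)"
    unfolding m_def by (rule LeastI_ex)
  moreover have "y \<in> X \<longleftrightarrow> y \<in> Y" if "y < m" for y
    using not_less_Least[of y "\<lambda>y. (y \<in> X) \<noteq> (y \<in> Y)"] that unfolding m_def by blast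
  ultimately show ?thesis
    using that by blast
qed

lemma lexval_lessE:
  assumes X: "X \<subseteq> {..n}" and Y: "Y \<subseteq> {..n}" and less: "lexval n Y < lexval n X"
  obtains m where "m \<in> X" "m \<notin> Y" "\<And>y. y < m \<Longrightarrow> y \<in> X \<longleftrightarrow> y \<in> Y"
proof -
  have "X \<noteq> Y"
    using less by auto
  then show ?thesis
  proof (cases rule: first_difference)
    case (1 m)
    then show ?thesis by (rule that)
  next
    case (2 m)
    then have "lexval n X < lexval n Y"
      by (intro lexval_less[OF Y X]) auto
    with less show ?thesis by simp
  qed
qed

lemma lexval_inject:
  assumes X: "X \<subseteq> {..n}" and Y: "Y \<subseteq> {..n}" and eq: "lexval n X = lexval n Y"
  shows "X = Y"
proof (rule ccontr)
  assume "X \<noteq> Y"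
  then show False
  proof (cases rule: first_difference)
    case (1 m)
    then show ?thesis
      using lexval_less[OF X Y] eq by force
  next
    case (2 m)
    then show ?thesis
      using lexval_less[OF Y X] eq by force
  qed
qed

text \<open>For distinct sets both sides ask whether the least element of the symmetric difference
  lies in \<open>A\<close>. Earlier sets have larger values, hence the reversed inequality.\<close>

lemma lex_prec_iff_lexval:
  assumes A: "A \<subseteq> {..n}" and B: "B \<subseteq> {..n}"
  shows "lex_prec A B \<longleftrightarrow> lexval n B \<le> lexval n A"
proof
  have fin: "finite (A - B)" "finite (B - A)" "finite A"
    using A B finite_subset by blast+
  show "lexval n B \<le> lexval n A" if "lex_prec A B"
  proof (cases "B \<subseteq> A")
    case True
    then show ?thesis
      using fin by (simp add: lexval_mono)
  next
    case False
    with that have ne: "A - B \<noteq> {}" "B - A \<noteq> {}" and less: "Min (A - B) < Min (B - A)"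
      by (auto simp: lex_prec_def)
    have "Min (A - B) \<in> A - B"
      using Min_in[OF fin(1) ne(1)] .
    moreover have "y \<in> A" if "y < Min (A - B)" "y \<in> B" for y
      using that less fin by (metis DiffI Min_le leD less_trans)
    ultimately have "lexval n B < lexval n A"
      by (intro lexval_less[OF A B]) auto
    then show ?thesis by simp
  qed
  show "lex_prec A B" if le: "lexval n B \<le> lexval n A"
  proof (cases "B \<subseteq> A")
    case True
    then show ?thesis by (simp add: lex_prec_def)
  next
    case False
    then have "lexval n B \<noteq> lexval n A"
      using lexval_inject[OF A B] by force
    with le have "lexval n B < lexval n A" by simp
    then obtain m where m: "m \<in> A" "m \<notin> B" "\<And>y. y < m \<Longrightarrow> y \<in> A \<longleftrightarrow> y \<in> B"
      using lexval_lessE[OF A B] by blast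
    have "Min (A - B) \<le> m"
      using m fin by simp
    also have "m < Min (B - A)"
      using m fin False by (subst Min_gr_iff) (auto, metis linorder_neqE_nat)
    finally show ?thesis
      using False m by (auto simp: lex_prec_def)
  qed
qed

text \<open>Sets with trace \<open>P\<close> run from \<open>P\<close> to \<open>P\<close> with the
  whole tail added, whose value is one below the right end. A different trace pushes the value out
  of this range on one side.\<close>

lemma lexval_prefix_iff:
  assumes X: "X \<subseteq> {..n}" and P: "P \<subseteq> {..i}" and i: "i \<le> n"
  shows "X \<inter> {..i} = P \<longleftrightarrow> lexval n P \<le> lexval n X \<and> lexval n X < lexval n P + 2 ^ (n - i)"
proof -
  let ?Q = "P \<union> {Suc i..n}"
  have P': "P \<subseteq> {..n}" and Q: "?Q \<subseteq> {..n}"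
    using P i by auto
  have fin: "finite P"
    using P finite_subset by blast
  have Qval: "lexval n ?Q + 1 = lexval n P + 2 ^ (n - i)"
    using P fin lexval_tail[OF i] by (subst lexval_Un_disjoint) auto
  show ?thesis
  proof (cases "X \<inter> {..i} = P")
    case True
    have "lexval n P \<le> lexval n X" "lexval n X \<le> lexval n ?Q"
      using True X fin by (auto intro!: lexval_mono intro: finite_subset)
    then show ?thesis
      using True Qval by auto
  next
    case False
    then show ?thesis
    proof (cases rule: first_difference)
      case (1 m)
      then have "m \<notin> P" "m \<le> i"
        by auto
      then have "lexval n ?Q < lexval n X"
        using 1 by (intro lexval_less[OF X Q, of m]) auto
      then show ?thesis
        using False Qval by auto
    next
      case (2 m)
      then have "m \<le> i"
        using P by auto
      then have "lexval n X < lexval n P"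
        using 2 by (intro lexval_less[OF P' X, of m]) auto
      then show ?thesis
        using False by auto
    qed
  qed
qed

section \<open>Simultaneous UV-compressions and lexicographic initial segments\<close>

section \<open>Compression of cross-intersecting pairs\<close>

text \<open>The UV-compression as a map on single members; the compressed family is the image of
  \<open>\<F>\<close>. A set whose target is occupied stays put, which makes the map injective on
  \<open>\<F>\<close>.\<close>

definition compress :: "'a set \<Rightarrow> 'a set \<Rightarrow> 'a set set \<Rightarrow> 'a set \<Rightarrow> 'a set" where
  "compress U V \<F> F =
     (if V \<subseteq> F \<and> U \<inter> F = {} \<and> (F - V) \<union> U \<notin> \<F> then (F - V) \<union> U else F)"

definition compressed :: "'a set \<Rightarrow> 'a set \<Rightarrow> 'a set set \<Rightarrow> bool" where
  "compressed U V \<F> \<longleftrightarrow> (\<forall>F\<in>\<F>. V \<subseteq> F \<longrightarrow> U \<inter> F = {} \<longrightarrow> (F - V) \<union> U \<in> \<F>)"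

lemma inj_on_compress: "inj_on (compress U V \<F>) \<F>"
  unfolding inj_on_def compress_def by (auto split: if_splits)

lemma compress_in_nsets:
  assumes \<F>: "\<F> \<subseteq> nsets X a" and UV: "U \<subseteq> X" "finite X" "card U = card V"
  shows "compress U V \<F> ` \<F> \<subseteq> nsets X a"
proof
  fix G assume "G \<in> compress U V \<F> ` \<F>"
  then obtain F where F: "F \<in> \<F>" "G = compress U V \<F> F"
    by blast
  then have F': "F \<subseteq> X" "finite F" "card F = a"
    using \<F> by (auto simp: nsets_def)
  show "G \<in> nsets X a"
  proof (cases "V \<subseteq> F \<and> U \<inter> F = {} \<and> (F - V) \<union> U \<notin> \<F>")
    case True
    have "finite V" "finite U"
      using True F' UV finite_subset by metis+
    then have "card ((F - V) \<union> U) = card F"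
      using True F' UV card_mono[of F V]
      by (subst card_Un_disjoint) (auto simp: card_Diff_subset)
    then show ?thesis
      using True F F' UV finite_subset[OF UV(1,2)] by (auto simp: compress_def nsets_def)
  next
    case False
    then have "G = F"
      using F by (auto simp: compress_def)
    then show ?thesis
      using F' by (auto simp: nsets_def)
  qed
qed

text \<open>The total value is the potential of the argument: with \<open>Min U < Min V\<close> each
  moved set gains value through the new element \<open>Min U\<close>.\<close>

lemma lexval_compress:
  assumes \<F>: "\<F> \<subseteq> nsets X a" and X: "X \<subseteq> {..n}" and U: "U \<subseteq> X" and V: "V \<subseteq> X"
    and ne: "U \<noteq> {}" "V \<noteq> {}" and min: "Min U < Min V"
  shows "(\<Sum>F\<in>\<F>. lexval n F) \<le> (\<Sum>F\<in>compress U V \<F> ` \<F>. lexval n F)"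
    and "\<not> compressed U V \<F> \<Longrightarrow>
      (\<Sum>F\<in>\<F>. lexval n F) < (\<Sum>F\<in>compress U V \<F> ` \<F>. lexval n F)"
proof -
  have finX: "finite X"
    using X finite_subset by blast
  have fin: "finite \<F>"
    using finite_imp_finite_nsets[OF finX] \<F> finite_subset by blast
  have less: "lexval n F < lexval n ((F - V) \<union> U)" if "F \<in> \<F>" "V \<subseteq> F" "U \<inter> F = {}" for F
  proof (rule lexval_less)
    have finUV: "finite U" "finite V"
      using finX U V finite_subset by auto
    show "(F - V) \<union> U \<subseteq> {..n}" "F \<subseteq> {..n}"
      using that \<F> X U by (auto simp: nsets_def subset_iff)
    show "Min U \<in> (F - V) \<union> U" "Min U \<notin> F"
      using finUV ne that Min_in[of U] by blast+
    show "y \<in> (F - V) \<union> U" if "y < Min U" "y \<in> F" for y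
      using that min by (metis DiffI UnI1 Min_le finUV(2) leD less_trans)
  qed
  have le: "lexval n F \<le> lexval n (compress U V \<F> F)" if "F \<in> \<F>" for F
    using less[OF that] by (auto simp: compress_def)
  have eq: "(\<Sum>F\<in>compress U V \<F> ` \<F>. lexval n F) = (\<Sum>F\<in>\<F>. lexval n (compress U V \<F> F))"
    by (simp add: sum.reindex inj_on_compress)
  show "(\<Sum>F\<in>\<F>. lexval n F) \<le> (\<Sum>F\<in>compress U V \<F> ` \<F>. lexval n F)"
    unfolding eq by (rule sum_mono) (rule le)
  show "(\<Sum>F\<in>\<F>. lexval n F) < (\<Sum>F\<in>compress U V \<F> ` \<F>. lexval n F)"
    if "\<not> compressed U V \<F>"
  proof -
    obtain F where "F \<in> \<F>" "V \<subseteq> F" "U \<inter> F = {}" "(F - V) \<union> U \<notin> \<F>"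
      using \<open>\<not> compressed U V \<F>\<close> by (auto simp: compressed_def)
    then have "\<exists>F\<in>\<F>. lexval n F < lexval n (compress U V \<F> F)"
      using less by (auto simp: compress_def)
    then show ?thesis
      unfolding eq using fin le by (intro sum_strict_mono_ex1) auto
  qed
qed

(* A set B meeting V only partly would have to move, along the smaller pair (U', V \<inter> B) with
   Min U \<in> U', to a set disjoint from A. *)
lemma compress_moved_disjoint:
  assumes cross: "cross_intersecting \<A> \<B>" and A: "A \<in> \<A>" "V \<subseteq> A" "U \<inter> A = {}"
    and B: "B \<in> \<B>" "B \<inter> ((A - V) \<union> U) = {}" "V \<subseteq> B \<Longrightarrow> (B - V) \<union> U \<in> \<B>"
    and UV: "card U = card V" "finite U" "finite V" "U \<noteq> {}" "Min U < Min V" "U \<inter> V = {}"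
    and stable: "\<And>U' V'. U' \<subseteq> U \<Longrightarrow> V' \<subseteq> V \<Longrightarrow> card U' = card V' \<Longrightarrow> card U' < card U \<Longrightarrow>
      U' \<noteq> {} \<Longrightarrow> Min U' < Min V' \<Longrightarrow> compressed U' V' \<B>"
  shows False
proof (cases "V \<subseteq> B")
  case True
  have "A \<inter> ((B - V) \<union> U) = {}"
    using A B by blast
  then show False
    using cross A B True by (auto simp: cross_intersecting_def)
next
  case False
  let ?V = "V \<inter> B"
  have "A \<inter> B \<noteq> {}"
    using cross A B by (auto simp: cross_intersecting_def)
  then have V: "?V \<noteq> {}" "?V \<subset> V"
    using B False by blast+
  then have cV: "0 < card ?V" "card ?V < card U"
    using UV by (auto simp: card_gt_0_iff psubset_card_mono)
  have "{Min U} \<subseteq> U" "card {Min U} \<le> card ?V"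
    using UV cV by auto
  then obtain U' where U': "{Min U} \<subseteq> U'" "U' \<subseteq> U" "card U' = card ?V"
    using exists_subset_between[of "{Min U}" "card ?V" U] UV cV by auto
  have U'_le: "Min U' \<le> Min U"
    using U' UV finite_subset[of U' U] by (intro Min_le) auto
  have "Min V \<le> Min ?V"
    using V UV by (intro Min_antimono) auto
  with U'_le UV have "Min U' < Min ?V"
    by (meson le_less_trans less_le_trans)
  then have "compressed U' ?V \<B>"
    using U' cV by (intro stable) auto
  moreover have "U' \<inter> B = {}"
    using B U' by blast
  ultimately have "(B - ?V) \<union> U' \<in> \<B>"
    using B by (auto simp: compressed_def)
  moreover have "A \<inter> ((B - ?V) \<union> U') = {}"
    using A B U' by blast
  ultimately show False
    using cross A by (auto simp: cross_intersecting_def)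
qed

lemma cross_intersecting_sym: "cross_intersecting \<A> \<B> \<longleftrightarrow> cross_intersecting \<B> \<A>"
  unfolding cross_intersecting_def by (metis inf_commute)

text \<open>Two moved sets share \<open>U\<close>, two unmoved sets are an original pair, and the
  mixed cases are excluded by \<open>compress_moved_disjoint\<close>; these need stability under
  smaller pairs.\<close>

lemma cross_intersecting_compress:
  assumes cross: "cross_intersecting \<A> \<B>"
    and UV: "card U = card V" "finite U" "finite V" "U \<noteq> {}" "Min U < Min V" "U \<inter> V = {}"
    and stable: "\<And>U' V'. U' \<subseteq> U \<Longrightarrow> V' \<subseteq> V \<Longrightarrow> card U' = card V' \<Longrightarrow> card U' < card U \<Longrightarrow>
      U' \<noteq> {} \<Longrightarrow> Min U' < Min V' \<Longrightarrow> compressed U' V' \<A> \<and> compressed U' V' \<B>"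
  shows "cross_intersecting (compress U V \<A> ` \<A>) (compress U V \<B> ` \<B>)"
proof -
  have "compress U V \<A> A \<inter> compress U V \<B> B \<noteq> {}" if AB: "A \<in> \<A>" "B \<in> \<B>" for A B
  proof
    assume disj: "compress U V \<A> A \<inter> compress U V \<B> B = {}"
    let ?mA = "V \<subseteq> A \<and> U \<inter> A = {} \<and> (A - V) \<union> U \<notin> \<A>"
    let ?mB = "V \<subseteq> B \<and> U \<inter> B = {} \<and> (B - V) \<union> U \<notin> \<B>"
    consider "?mA" "?mB" | "?mA" "\<not> ?mB" | "\<not> ?mA" "?mB" | "\<not> ?mA" "\<not> ?mB"
      by blast
    then show False
    proof cases
      case 1
      then show False
        using disj UV(4) by (auto simp: compress_def)
    next
      case 2
      then have "B \<inter> ((A - V) \<union> U) = {}"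
        using disj by (auto simp: compress_def split: if_splits)
      \<comment> \<open>As \<open>B\<close> avoids \<open>U\<close> and does not move,
        \<open>V \<subseteq> B\<close> puts its target into \<open>\<B>\<close>.\<close>
      then show False
        using 2 AB stable by (intro compress_moved_disjoint[OF cross _ _ _ _ _ _ UV]) auto
    next
      case 3
      then have "A \<inter> ((B - V) \<union> U) = {}"
        using disj by (auto simp: compress_def split: if_splits)
      moreover have "cross_intersecting \<B> \<A>"
        using cross cross_intersecting_sym by blast
      ultimately show False
        using 3 AB stable
        by (intro compress_moved_disjoint[OF \<open>cross_intersecting \<B> \<A>\<close> _ _ _ _ _ _ UV]) auto
    next
      case 4
      then have "A \<inter> B = {}"
        using disj by (auto simp: compress_def split: if_splits)
      then show False
        using cross AB by (auto simp: cross_intersecting_def)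
    qed
  qed
  then show ?thesis
    by (auto simp: cross_intersecting_def)
qed

definition lex_initial :: "nat \<Rightarrow> nat set \<Rightarrow> nat \<Rightarrow> nat set set \<Rightarrow> bool" where
  "lex_initial n X a \<F> \<longleftrightarrow> \<F> \<subseteq> nsets X a \<and>
     (\<forall>F\<in>\<F>. \<forall>G\<in>nsets X a. lexval n F < lexval n G \<longrightarrow> G \<in> \<F>)"

text \<open>For a member \<open>F\<close> and an earlier \<open>G\<close> of equal size, replacing
  \<open>F - G\<close> by \<open>G - F\<close> turns \<open>F\<close> into \<open>G\<close>; the
  first difference lies in \<open>G\<close>, so this replacement is one of the stable
  compressions.\<close>

lemma lex_initial_if_compressed:
  assumes \<F>: "\<F> \<subseteq> nsets X a" and X: "X \<subseteq> {..n}"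
    and stable: "\<And>U V. U \<subseteq> X \<Longrightarrow> V \<subseteq> X \<Longrightarrow> card U = card V \<Longrightarrow> U \<noteq> {} \<Longrightarrow> U \<inter> V = {} \<Longrightarrow>
      Min U < Min V \<Longrightarrow> compressed U V \<F>"
  shows "lex_initial n X a \<F>"
  unfolding lex_initial_def
proof (intro conjI ballI impI \<F>)
  fix F G assume F: "F \<in> \<F>" and G: "G \<in> nsets X a" and less: "lexval n F < lexval n G"
  have F': "F \<subseteq> X" "finite F" "card F = a" and G': "G \<subseteq> X" "finite G" "card G = a"
    using F G \<F> by (auto simp: nsets_def)
  obtain m where m: "m \<in> G" "m \<notin> F" "\<And>y. y < m \<Longrightarrow> y \<in> G \<longleftrightarrow> y \<in> F"
    using lexval_lessE[OF _ _ less] F' G' X by blast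
  have card: "card (G - F) = card (F - G)"
    using F' G' by (metis card_Diff_subset_Int Int_commute finite_Int)
  have "F - G \<noteq> {}"
    using card m F' G' by (metis DiffI card_0_eq empty_iff finite_Diff)
  then have "Min (G - F) \<le> m" "m < Min (F - G)"
    using m F' G' by (auto simp: Min_gr_iff) (metis linorder_neqE_nat)
  then have "Min (G - F) < Min (F - G)"
    by (rule le_less_trans)
  then have "compressed (G - F) (F - G) \<F>"
    using F' G' m card by (intro stable) auto
  then have "(F - (F - G)) \<union> (G - F) \<in> \<F>"
    using F by (auto simp: compressed_def)
  also have "(F - (F - G)) \<union> (G - F) = G"
    by blast
  finally show "G \<in> \<F>" .
qed

text \<open>Among cross-intersecting pairs of the given sizes, one of maximal total value is stable
  under every compression, hence consists of initial segments.\<close>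

lemma cross_intersecting_lex_initial:
  assumes \<A>: "\<A> \<subseteq> nsets X a" and \<B>: "\<B> \<subseteq> nsets X b" and X: "X \<subseteq> {..n}"
    and cross: "cross_intersecting \<A> \<B>"
  obtains \<A>' \<B>' where "lex_initial n X a \<A>'" "lex_initial n X b \<B>'"
    "card \<A>' = card \<A>" "card \<B>' = card \<B>" "cross_intersecting \<A>' \<B>'"
proof -
  have finX: "finite X"
    using X finite_subset by blast
  define good where "good = (\<lambda>(\<A>', \<B>'). \<A>' \<subseteq> nsets X a \<and> \<B>' \<subseteq> nsets X b \<and>
    card \<A>' = card \<A> \<and> card \<B>' = card \<B> \<and> cross_intersecting \<A>' \<B>')"
  define weight where "weight = (\<lambda>(\<A>', \<B>'). (\<Sum>F\<in>\<A>'. lexval n F) + (\<Sum>F\<in>\<B>'. lexval n F))"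
  have "{p. good p} \<subseteq> Pow (nsets X a) \<times> Pow (nsets X b)"
    by (auto simp: good_def)
  then have "finite {p. good p}"
    by (rule finite_subset) (simp add: finite_imp_finite_nsets finX)
  moreover have "good (\<A>, \<B>)"
    using assms by (simp add: good_def)
  ultimately have "finite (weight ` {p. good p})" "weight ` {p. good p} \<noteq> {}"
    by auto
  from Max_in[OF this] Max_ge[OF this(1)]
  obtain p where p: "good p" "\<And>q. good q \<Longrightarrow> weight q \<le> weight p"
    by fastforce
  obtain \<A>' \<B>' where AB: "p = (\<A>', \<B>')"
    by fastforce
  have good: "\<A>' \<subseteq> nsets X a" "\<B>' \<subseteq> nsets X b" "card \<A>' = card \<A>" "card \<B>' = card \<B>"
    "cross_intersecting \<A>' \<B>'"
    using p AB by (auto simp: good_def)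
  have stable: "compressed U V \<A>' \<and> compressed U V \<B>'"
    if "U \<subseteq> X" "V \<subseteq> X" "card U = card V" "U \<noteq> {}" "U \<inter> V = {}" "Min U < Min V" for U V
    using that
  \<comment> \<open>The induction hypothesis supplies the stability under smaller pairs that keeps
    the compressed families cross-intersecting.\<close>
  proof (induction "card U" arbitrary: U V rule: less_induct)
    case less
    have fin: "finite U" "finite V"
      using less.prems(1,2) finX by (blast intro: finite_subset)+
    then have "V \<noteq> {}"
      using less.prems by auto
    let ?A = "compress U V \<A>' ` \<A>'" and ?B = "compress U V \<B>' ` \<B>'"
    have "cross_intersecting ?A ?B"
      by (rule cross_intersecting_compress[OF good(5) less.prems(3) fin less.prems(4,6,5)])
        (rule less.hyps, use less.prems in auto)
    then have "good (?A, ?B)"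
      using good compress_in_nsets[OF _ less.prems(1) finX less.prems(3)]
      by (simp add: good_def card_image inj_on_compress)
    then have le: "weight (?A, ?B) \<le> weight (\<A>', \<B>')"
      using p AB by blast
    note gA = lexval_compress[OF good(1) X less.prems(1,2,4) \<open>V \<noteq> {}\<close> less.prems(6)]
    note gB = lexval_compress[OF good(2) X less.prems(1,2,4) \<open>V \<noteq> {}\<close> less.prems(6)]
    \<comment> \<open>Neither part of the weight can fall, so an uncompressed family would make it
      rise, against maximality.\<close>
    show ?case
      using le gA gB by (fastforce simp: weight_def)
  qed
  have "lex_initial n X a \<A>'" "lex_initial n X b \<B>'"
    using stable good X by (auto intro!: lex_initial_if_compressed)
  then show ?thesis
    using good that by blast
qed

section \<open>Double counting between levels and the size of a threshold pair\<close>

section \<open>Sizes of threshold pairs\<close>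

lemma card_nsets: "finite A \<Longrightarrow> card (nsets A r) = card A choose r"
proof -
  assume fin: "finite A"
  then have "nsets A r = {B. B \<subseteq> A \<and> card B = r}"
    by (auto simp: nsets_def intro: finite_subset)
  with fin show ?thesis
    by (simp add: n_subsets)
qed

text \<open>Double counting of the inclusions \<open>B \<subseteq> D\<close>: each \<open>D\<close>
  contains \<open>e choose b\<close> sets \<open>B\<close>, and each \<open>B\<close> lies in at
  most \<open>e choose (e - b)\<close> of the \<open>D\<close>, the same number, since
  \<open>Z - B\<close> has \<open>e\<close> elements.\<close>

lemma card_le_card_subsets_of_complementary_size:
  assumes Z: "finite Z" "card Z = b + e" and le: "b \<le> e" and Y: "\<Y> \<subseteq> nsets Z e"
  shows "card \<Y> \<le> card {B \<in> nsets Z b. \<exists>D\<in>\<Y>. B \<subseteq> D}"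
proof -
  define N where "N = {B \<in> nsets Z b. \<exists>D\<in>\<Y>. B \<subseteq> D}"
  have finY: "finite \<Y>" and finN: "finite N"
    using Y finite_imp_finite_nsets[OF Z(1)] by (auto simp: N_def intro: finite_subset)
  have "card {B \<in> N. B \<subseteq> D} = e choose b" if "D \<in> \<Y>" for D
  proof -
    have "D \<subseteq> Z" "finite D" "card D = e"
      using that Y by (auto simp: nsets_def)
    moreover have "{B \<in> N. B \<subseteq> D} = nsets D b"
      using that calculation by (auto simp: N_def nsets_def)
    ultimately show ?thesis
      by (simp add: card_nsets)
  qed
  then have "card \<Y> * (e choose b) = (\<Sum>D\<in>\<Y>. card {B \<in> N. B \<subseteq> D})"
    by simp
  also have "\<dots> = (\<Sum>B\<in>N. card {D \<in> \<Y>. B \<subseteq> D})"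
    using sum_multicount_gen[of \<Y> N "\<lambda>D B. B \<subseteq> D" "\<lambda>B. card {D \<in> \<Y>. B \<subseteq> D}"] finY finN by simp
  also have "\<dots> \<le> (\<Sum>B\<in>N. e choose b)"
  proof (rule sum_mono)
    fix B assume "B \<in> N"
    then have B: "B \<subseteq> Z" "finite B" "card B = b"
      by (auto simp: N_def nsets_def)
    have "inj_on (\<lambda>D. D - B) {D \<in> \<Y>. B \<subseteq> D}"
      by (auto simp: inj_on_def)
    moreover have "(\<lambda>D. D - B) ` {D \<in> \<Y>. B \<subseteq> D} \<subseteq> nsets (Z - B) (e - b)"
      using B Y by (auto simp: nsets_def card_Diff_subset)
    ultimately have "card {D \<in> \<Y>. B \<subseteq> D} \<le> card (nsets (Z - B) (e - b))"
      by (rule card_inj_on_le) (use Z in \<open>simp add: finite_imp_finite_nsets\<close>)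
    also have "\<dots> = e choose (e - b)"
      using B Z by (simp add: card_nsets card_Diff_subset)
    finally show "card {D \<in> \<Y>. B \<subseteq> D} \<le> e choose b"
      by (simp add: binomial_symmetric[OF le])
  qed
  also have "\<dots> = card N * (e choose b)"
    by simp
  finally show ?thesis
    using le by (simp add: N_def)
qed

lemma nsets_prefix_image:
  assumes P: "P \<subseteq> {2..i}" and i: "1 \<le> i" "i \<le> n" and r: "card P \<le> r"
  shows "{X \<in> nsets {2..n} r. X \<inter> {..i} = P} = (\<union>) P ` nsets {Suc i..n} (r - card P)"
    (is "?L = ?R")
proof
  have finP: "finite P"
    using P finite_subset by blast
  show "?L \<subseteq> ?R"
  proof
    fix X assume "X \<in> ?L"
    then have X: "X \<subseteq> {2..n}" "finite X" "card X = r" "X \<inter> {..i} = P"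
      by (auto simp: nsets_def)
    have "X = P \<union> (X - P)"
      using X by blast
    moreover have "X - P \<in> nsets {Suc i..n} (r - card P)"
      using X finP by (auto simp: nsets_def card_Diff_subset)
    ultimately show "X \<in> ?R"
      by blast
  qed
  show "?R \<subseteq> ?L"
  proof
    fix X assume "X \<in> ?R"
    then obtain Y where Y: "X = P \<union> Y" "Y \<subseteq> {Suc i..n}" "finite Y" "card Y = r - card P"
      by (auto simp: nsets_def)
    have "P \<inter> Y = {}"
      using P Y by fastforce
    then have "card X = r"
      using Y r finP by (simp add: card_Un_disjoint)
    then show "X \<in> ?L"
      using Y P i finP by (auto simp: nsets_def)
  qed
qed

lemma inj_on_Un_prefix:
  assumes "P \<subseteq> {2..i}"
  shows "inj_on ((\<union>) P) (nsets {Suc i..n} r)"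
proof (rule inj_onI)
  fix X Y assume "X \<in> nsets {Suc i..n} r" "Y \<in> nsets {Suc i..n} r" "P \<union> X = P \<union> Y"
  moreover have "P \<inter> {Suc i..n} = {}"
    using assms by auto
  ultimately show "X = Y"
    by (auto simp: nsets_def)
qed

lemma card_nsets_prefix:
  assumes P: "P \<subseteq> {2..i}" and i: "1 \<le> i" "i \<le> n" and r: "card P \<le> r"
  shows "card {X \<in> nsets {2..n} r. lexval n P \<le> lexval n X \<and> lexval n X < lexval n P + 2 ^ (n - i)}
    = (n - i) choose (r - card P)"
proof -
  have "{X \<in> nsets {2..n} r. lexval n P \<le> lexval n X \<and> lexval n X < lexval n P + 2 ^ (n - i)}
    = {X \<in> nsets {2..n} r. X \<inter> {..i} = P}"
  proof (rule Collect_cong, rule conj_cong[OF refl])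
    fix X assume "X \<in> nsets {2..n} r"
    then have "X \<subseteq> {..n}" "P \<subseteq> {..i}"
      using P by (auto simp: nsets_def)
    then show "(lexval n P \<le> lexval n X \<and> lexval n X < lexval n P + 2 ^ (n - i)) = (X \<inter> {..i} = P)"
      using lexval_prefix_iff i by simp
  qed
  also have "\<dots> = (\<union>) P ` nsets {Suc i..n} (r - card P)"
    by (rule nsets_prefix_image[OF P i r])
  finally show ?thesis
    using inj_on_Un_prefix[OF P] by (simp add: card_image card_nsets)
qed

text \<open>Total size of the threshold pair at \<open>c\<close>. Using complements in the first
  family makes the pair cross-intersecting: a \<open>B\<close> missing \<open>A\<close> would lie in
  the complement of \<open>A\<close> and have a value below \<open>c\<close>.\<close>

definition pair_size :: "nat \<Rightarrow> nat \<Rightarrow> nat \<Rightarrow> nat" where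
  "pair_size n k c = card {A \<in> nsets {2..n} (k - 1). lexval n ({2..n} - A) < c}
     + card {B \<in> nsets {2..n} k. c \<le> lexval n B}"

text \<open>The ground set has \<open>n - 1\<close> points, so complements of (k-1)-sets are
  (n-k)-sets; both parts of \<open>pair_size\<close> then become counts along one axis of
  values.\<close>

lemma card_nsets_complement:
  assumes k: "1 \<le> k" "k \<le> n"
  shows "card {A \<in> nsets {2..n} (k - 1). Q ({2..n} - A)} = card {D \<in> nsets {2..n} (n - k). Q D}"
proof (rule bij_betw_same_card[of "\<lambda>A. {2..n} - A"], rule bij_betwI[of _ _ _ "\<lambda>A. {2..n} - A"])
  have "{2..n} - X \<in> nsets {2..n} (n - 1 - r)" if "X \<in> nsets {2..n} r" for X r
    using that by (auto simp: nsets_def card_Diff_subset)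
  note * = this
  have eq: "n - 1 - (k - 1) = n - k" "n - 1 - (n - k) = k - 1"
    using k by auto
  have dbl: "{2..n} - ({2..n} - X) = X" if "X \<in> nsets {2..n} r" for X r
    using that by (auto simp: nsets_def)
  show "(\<lambda>A. {2..n} - A) \<in> {A \<in> nsets {2..n} (k - 1). Q ({2..n} - A)} \<rightarrow> {D \<in> nsets {2..n} (n - k). Q D}"
    using *[of _ "k - 1"] unfolding eq by auto
  show "(\<lambda>A. {2..n} - A) \<in> {D \<in> nsets {2..n} (n - k). Q D} \<rightarrow> {A \<in> nsets {2..n} (k - 1). Q ({2..n} - A)}"
    using *[of _ "n - k"] dbl[of _ "n - k"] unfolding eq by auto
  show "{2..n} - ({2..n} - X) = X" if "X \<in> {A \<in> nsets {2..n} (k - 1). Q ({2..n} - A)}" for X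
    using that dbl by blast
  show "{2..n} - ({2..n} - X) = X" if "X \<in> {D \<in> nsets {2..n} (n - k). Q D}" for X
    using that dbl by blast
qed

text \<open>Lowering the threshold from \<open>hi\<close> to \<open>lo\<close> admits the k-sets
  with values in between and expels the (k-1)-sets whose complements lie there. The additive form
  avoids truncated subtraction.\<close>

lemma pair_size_shift:
  assumes k: "1 \<le> k" "k \<le> n" and le: "lo \<le> hi"
  shows "pair_size n k lo + card {D \<in> nsets {2..n} (n - k). lo \<le> lexval n D \<and> lexval n D < hi}
    = pair_size n k hi + card {B \<in> nsets {2..n} k. lo \<le> lexval n B \<and> lexval n B < hi}"
proof -
  have fin: "finite (nsets {2..n} r)" for r
    by (simp add: finite_imp_finite_nsets)
  have "{D \<in> nsets {2..n} (n - k). lexval n D < hi} = {D \<in> nsets {2..n} (n - k). lexval n D < lo}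
      \<union> {D \<in> nsets {2..n} (n - k). lo \<le> lexval n D \<and> lexval n D < hi}"
    using le by auto
  then have "card {D \<in> nsets {2..n} (n - k). lexval n D < hi}
      = card {D \<in> nsets {2..n} (n - k). lexval n D < lo}
      + card {D \<in> nsets {2..n} (n - k). lo \<le> lexval n D \<and> lexval n D < hi}"
    using fin by (simp add: card_Un_disjoint disjoint_iff)
  moreover have "{B \<in> nsets {2..n} k. lo \<le> lexval n B} = {B \<in> nsets {2..n} k. hi \<le> lexval n B}
      \<union> {B \<in> nsets {2..n} k. lo \<le> lexval n B \<and> lexval n B < hi}"
    using le by auto
  then have "card {B \<in> nsets {2..n} k. lo \<le> lexval n B} = card {B \<in> nsets {2..n} k. hi \<le> lexval n B}
      + card {B \<in> nsets {2..n} k. lo \<le> lexval n B \<and> lexval n B < hi}"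
    using fin by (simp add: card_Un_disjoint disjoint_iff)
  moreover note card_nsets_complement[OF k, of "\<lambda>D. lexval n D < lo"]
    card_nsets_complement[OF k, of "\<lambda>D. lexval n D < hi"]
  ultimately show ?thesis
    by (simp add: pair_size_def)
qed

lemma pair_size_block:
  assumes P: "P \<subseteq> {2..i}" and i: "1 \<le> i" "i \<le> n" and k: "1 \<le> k" "2 * k < n" "card P \<le> k"
  shows "pair_size n k (lexval n P) + ((n - i) choose (n - k - card P))
    = pair_size n k (lexval n P + 2 ^ (n - i)) + ((n - i) choose (k - card P))"
  using pair_size_shift[of k n "lexval n P" "lexval n P + 2 ^ (n - i)"]
    card_nsets_prefix[OF P i] k by simp

text \<open>For \<open>i = 2 * card P\<close> the tail sizes \<open>b\<close> and \<open>e\<close>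
  are complementary in the remaining \<open>n - i\<close> points. Tails that keep the value below
  \<open>c\<close> are closed under subsets, so by the double count lowering the threshold to
  \<open>lexval n P\<close> gains at least what it loses.\<close>

lemma pair_size_balanced_block:
  assumes P: "P \<subseteq> {2..i}" and i: "1 \<le> i" "i = 2 * card P" and k: "1 \<le> k" "2 * k < n" "card P \<le> k"
    and c: "lexval n P \<le> c" "c \<le> lexval n P + 2 ^ (n - i)"
  shows "pair_size n k c \<le> pair_size n k (lexval n P)"
proof -
  have "i \<le> n"
    using i k by simp
  define Z where "Z = {Suc i..n}"
  define b where "b = k - card P"
  define e where "e = n - k - card P"
  have be: "card Z = b + e" "b \<le> e"
    using i k by (auto simp: Z_def b_def e_def)
  have "P \<subseteq> {..i}" and finP: "finite P"
    using P finite_subset by auto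
  have pre: "{X \<in> nsets {2..n} r. lexval n P \<le> lexval n X \<and> lexval n X < c}
      = (\<union>) P ` {Y \<in> nsets Z (r - card P). lexval n (P \<union> Y) < c}" if "card P \<le> r" for r
  proof -
    have "{X \<in> nsets {2..n} r. lexval n P \<le> lexval n X \<and> lexval n X < c}
      = {X \<in> nsets {2..n} r. X \<inter> {..i} = P \<and> lexval n X < c}"
    proof (rule Collect_cong, rule conj_cong[OF refl])
      fix X assume "X \<in> nsets {2..n} r"
      then have "X \<subseteq> {..n}"
        by (auto simp: nsets_def)
      then show "(lexval n P \<le> lexval n X \<and> lexval n X < c) = (X \<inter> {..i} = P \<and> lexval n X < c)"
        using lexval_prefix_iff[OF _ \<open>P \<subseteq> {..i}\<close> \<open>i \<le> n\<close>] c by auto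
    qed
    also have "\<dots> = {X \<in> {X \<in> nsets {2..n} r. X \<inter> {..i} = P}. lexval n X < c}"
      by blast
    also have "\<dots> = (\<union>) P ` {Y \<in> nsets Z (r - card P). lexval n (P \<union> Y) < c}"
      unfolding nsets_prefix_image[OF P i(1) \<open>i \<le> n\<close> that] Z_def by blast
    finally show ?thesis .
  qed
  have cards: "card ((\<union>) P ` {Y \<in> nsets Z r. lexval n (P \<union> Y) < c})
      = card {Y \<in> nsets Z r. lexval n (P \<union> Y) < c}" for r
    unfolding Z_def by (rule card_image, rule inj_on_subset[OF inj_on_Un_prefix[OF P]]) blast
  have "card {Y \<in> nsets Z e. lexval n (P \<union> Y) < c}
      \<le> card {B \<in> nsets Z b. \<exists>D\<in>{Y \<in> nsets Z e. lexval n (P \<union> Y) < c}. B \<subseteq> D}"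
    by (rule card_le_card_subsets_of_complementary_size[OF _ be]) (auto simp: Z_def)
  also have "\<dots> \<le> card {B \<in> nsets Z b. lexval n (P \<union> B) < c}"
  proof (rule card_mono)
    show "finite {B \<in> nsets Z b. lexval n (P \<union> B) < c}"
      by (simp add: Z_def finite_imp_finite_nsets)
    show "{B \<in> nsets Z b. \<exists>D\<in>{Y \<in> nsets Z e. lexval n (P \<union> Y) < c}. B \<subseteq> D}
        \<subseteq> {B \<in> nsets Z b. lexval n (P \<union> B) < c}"
    proof clarsimp
      fix B D assume "D \<in> nsets Z e" "lexval n (P \<union> D) < c" "B \<subseteq> D"
      moreover have "lexval n (P \<union> B) \<le> lexval n (P \<union> D)"
        using calculation finP by (intro lexval_mono) (auto simp: nsets_def)
      ultimately show "lexval n (P \<union> B) < c"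
        by simp
    qed
  qed
  finally have "card {X \<in> nsets {2..n} (n - k). lexval n P \<le> lexval n X \<and> lexval n X < c}
      \<le> card {X \<in> nsets {2..n} k. lexval n P \<le> lexval n X \<and> lexval n X < c}"
    using k by (simp add: pre cards b_def e_def)
  then show ?thesis
    using pair_size_shift[of k n "lexval n P" c] k c by simp
qed

section \<open>Reflection under complements, and reduction of arbitrary pairs to thresholds\<close>

lemma lexval_ground: "2 \<le> n \<Longrightarrow> lexval n {2..n} + 1 = 2 ^ (n - 1)"
  using lexval_tail[of 1 n] by (simp add: numeral_2_eq_2)

lemma lexval_complement:
  assumes "2 \<le> n" "A \<subseteq> {2..n}"
  shows "lexval n A + lexval n ({2..n} - A) + 1 = 2 ^ (n - 1)"
proof -
  have "finite A"
    using assms finite_subset by blast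
  then have "lexval n A + lexval n ({2..n} - A) = lexval n (A \<union> ({2..n} - A))"
    by (subst lexval_Un_disjoint) auto
  also have "A \<union> ({2..n} - A) = {2..n}"
    using assms by blast
  finally show ?thesis
    using lexval_ground assms by simp
qed

text \<open>If \<open>B\<close> is not inside \<open>D\<close>, keep the elements of
  \<open>B\<close> before the first difference \<open>m\<close>, add \<open>m\<close>, and fill up
  arbitrarily inside \<open>D\<close>. The kept part is a proper subset of \<open>B\<close>, so
  \<open>m\<close> still fits.\<close>

lemma exists_subset_lexval_ge:
  assumes B: "B \<subseteq> {..n}" "card B = k" and D: "D \<subseteq> {..n}" "k \<le> card D"
    and le: "lexval n B \<le> lexval n D"
  obtains C where "C \<subseteq> D" "card C = k" "lexval n B \<le> lexval n C"
proof (cases "B \<subseteq> D")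
  case True
  then show ?thesis
    using that B by blast
next
  case False
  have fin: "finite B" "finite D"
    using B D finite_subset by blast+
  have "lexval n B < lexval n D"
    using le lexval_inject[OF B(1) D(1)] False by force
  then obtain m where m: "m \<in> D" "m \<notin> B" "\<And>y. y < m \<Longrightarrow> y \<in> D \<longleftrightarrow> y \<in> B"
    using lexval_lessE[OF D(1) B(1)] by blast
  have "B \<inter> {..<m} \<subset> B"
    using False m by auto
  then have "card (B \<inter> {..<m}) < k"
    using B fin psubset_card_mono by blast
  then have "card (insert m (B \<inter> {..<m})) \<le> k"
    by (simp add: card_insert_if fin)
  moreover have "insert m (B \<inter> {..<m}) \<subseteq> D"
    using m by auto
  ultimately obtain C where C: "insert m (B \<inter> {..<m}) \<subseteq> C" "C \<subseteq> D" "card C = k"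
    using exists_subset_between D fin by metis
  have "lexval n B < lexval n C"
    using C D B m by (intro lexval_less[where m = m]) auto
  then show ?thesis
    using that C by simp
qed

text \<open>After compression the second family is cut out by the value of its smallest member
  \<open>B\<close>, and this value is the threshold. The equation for \<open>card \<B>\<close>
  serves to locate \<open>B\<close> among the resistant values.\<close>

lemma cross_intersecting_card_le_pair_size:
  assumes \<A>: "\<A> \<subseteq> nsets {2..n} (k - 1)" and \<B>: "\<B> \<subseteq> nsets {2..n} k" "\<B> \<noteq> {}"
    and cross: "cross_intersecting \<A> \<B>" and k: "1 \<le> k" "2 * k < n"
  obtains B where "B \<in> nsets {2..n} k" "card \<B> = card {C \<in> nsets {2..n} k. lexval n B \<le> lexval n C}"
    "card \<A> + card \<B> \<le> pair_size n k (lexval n B)"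
proof -
  have ground: "{2..n} \<subseteq> {..n}"
    by auto
  have fin: "finite (nsets {2..n} r)" for r
    by (simp add: finite_imp_finite_nsets)
  obtain \<A>' \<B>' where lex: "lex_initial n {2..n} (k - 1) \<A>'" "lex_initial n {2..n} k \<B>'"
    and cards: "card \<A>' = card \<A>" "card \<B>' = card \<B>" and cross': "cross_intersecting \<A>' \<B>'"
    using cross_intersecting_lex_initial[OF \<A> \<B>(1) ground cross] by blast
  have sub: "\<A>' \<subseteq> nsets {2..n} (k - 1)" "\<B>' \<subseteq> nsets {2..n} k"
    using lex by (auto simp: lex_initial_def)
  have finB: "finite \<B>" "finite \<B>'"
    using \<B> sub fin finite_subset by blast+
  then have "\<B>' \<noteq> {}"
    using \<B> cards by auto
  then obtain B where B: "B \<in> \<B>'" "\<And>C. C \<in> \<B>' \<Longrightarrow> lexval n B \<le> lexval n C"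
    using ex_is_arg_min_if_finite[OF finB(2), of "lexval n"]
    by (auto simp: is_arg_min_linorder)
  have BX: "B \<in> nsets {2..n} k"
    using B sub by blast
  have B': "B \<subseteq> {..n}" "card B = k"
    using BX by (auto simp: nsets_def)
  have eq: "\<B>' = {C \<in> nsets {2..n} k. lexval n B \<le> lexval n C}"
  proof
    show "\<B>' \<subseteq> {C \<in> nsets {2..n} k. lexval n B \<le> lexval n C}"
      using B sub by blast
    show "{C \<in> nsets {2..n} k. lexval n B \<le> lexval n C} \<subseteq> \<B>'"
    proof clarify
      fix C assume C: "C \<in> nsets {2..n} k" "lexval n B \<le> lexval n C"
      then have "C \<subseteq> {..n}"
        by (auto simp: nsets_def)
      then have "lexval n B = lexval n C \<Longrightarrow> C = B"
        using lexval_inject[OF B'(1)] by blast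
      moreover have "C \<in> \<B>'" if "lexval n B < lexval n C"
        using C B lex(2) that unfolding lex_initial_def by blast
      ultimately show "C \<in> \<B>'"
        using C B by (metis le_neq_implies_less)
    qed
  qed
  \<comment> \<open>Otherwise the complement of \<open>A\<close>, having at least \<open>k\<close>
    elements, contains a member of \<open>\<B>'\<close> disjoint from \<open>A\<close>.\<close>
  have "lexval n ({2..n} - A) < lexval n B" if A: "A \<in> \<A>'" for A
  proof (rule ccontr)
    assume "\<not> lexval n ({2..n} - A) < lexval n B"
    then have le: "lexval n B \<le> lexval n ({2..n} - A)"
      by simp
    have "A \<subseteq> {2..n}" "finite A" "card A = k - 1"
      using A sub by (auto simp: nsets_def)
    then have "k \<le> card ({2..n} - A)"
      using k by (simp add: card_Diff_subset)
    moreover have "{2..n} - A \<subseteq> {..n}"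
      by auto
    ultimately obtain C where C: "C \<subseteq> {2..n} - A" "card C = k" "lexval n B \<le> lexval n C"
      using exists_subset_lexval_ge[OF B' _ _ le] by blast
    have "C \<in> nsets {2..n} k"
      using C by (auto simp: nsets_def intro: finite_subset)
    then have "C \<in> \<B>'"
      using C eq by blast
    then show False
      using A C cross' by (auto simp: cross_intersecting_def)
  qed
  then have "\<A>' \<subseteq> {A \<in> nsets {2..n} (k - 1). lexval n ({2..n} - A) < lexval n B}"
    using sub by blast
  then have "card \<A>' \<le> card {A \<in> nsets {2..n} (k - 1). lexval n ({2..n} - A) < lexval n B}"
    using fin by (intro card_mono) auto
  then have "card \<A> + card \<B> \<le> pair_size n k (lexval n B)"
    using cards eq by (simp add: pair_size_def)
  then show ?thesis
    using that[OF BX] cards eq by simp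
qed

lemma lex_family_eq:
  assumes "T \<subseteq> {2..n}"
  shows "lex_family n T r = {B \<in> nsets {2..n} r. lexval n T \<le> lexval n B}"
proof -
  have "lex_prec B (T \<inter> {2..n}) \<longleftrightarrow> lexval n T \<le> lexval n B" if "B \<in> nsets {2..n} r" for B
  proof -
    have "T \<inter> {2..n} = T" "T \<subseteq> {..n}" "B \<subseteq> {..n}"
      using assms that by (auto simp: nsets_def)
    then show ?thesis
      by (simp add: lex_prec_iff_lexval)
  qed
  then show ?thesis
    unfolding lex_family_def by blast
qed

section \<open>The partner of a set and the balance of its prefixes\<close>

section \<open>Resistant sets\<close>

text \<open>The set \<open>S\<close> that \<open>T\<close> determines in a resistant pair. For
  \<open>T = {2..n}\<close> it is \<open>{1, n}\<close>, in accordance with the pair of index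
  0.\<close>

definition partner :: "nat set \<Rightarrow> nat set" where
  "partner T = insert (Max T) ({1..Max T} - T)"

text \<open>Within \<open>{2..n}\<close> the partner is the complement of \<open>T\<close> with the
  tail after \<open>Max T\<close> replaced by \<open>Max T\<close>. By the geometric sum this raises
  the complement's value by exactly 1.\<close>

lemma lexval_partner:
  assumes T: "T \<subseteq> {2..n}" "T \<noteq> {}"
  shows "lexval n (partner T \<inter> {2..n}) + lexval n T = 2 ^ (n - 1)"
proof -
  have fin: "finite T"
    using T finite_subset by blast
  then have "Max T \<in> T"
    using T by simp
  then have j: "2 \<le> Max T" "Max T \<le> n"
    using T by auto
  have le: "x \<le> Max T" if "x \<in> T" for x
    using that fin by simp
  have "{2..n} - T = ({2..Max T} - T) \<union> {Suc (Max T)..n}"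
  proof (rule set_eqI)
    fix x show "x \<in> {2..n} - T \<longleftrightarrow> x \<in> ({2..Max T} - T) \<union> {Suc (Max T)..n}"
      using j le[of x] by auto
  qed
  then have "lexval n ({2..n} - T) = lexval n ({2..Max T} - T) + lexval n {Suc (Max T)..n}"
    by (metis (no_types, lifting) Diff_iff atLeastAtMost_iff disjoint_iff finite_Diff
        finite_atLeastAtMost lexval_Un_disjoint not_less_eq_eq)
  moreover have "partner T \<inter> {2..n} = insert (Max T) ({2..Max T} - T)"
    using j by (auto simp: partner_def)
  then have "lexval n (partner T \<inter> {2..n}) = 2 ^ (n - Max T) + lexval n ({2..Max T} - T)"
    using \<open>Max T \<in> T\<close> by (simp add: lexval_def)
  ultimately show ?thesis
    using lexval_tail[of "Max T" n] lexval_complement[of n T] T j by simp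
qed

text \<open>By the reflection, \<open>A\<close> has at least the value of the partner iff its
  complement has a value below that of \<open>T\<close>.\<close>

lemma pair_size_eq_card_lex_families:
  assumes T: "T \<subseteq> {2..n}" "T \<noteq> {}"
  shows "card (lex_family n (partner T) (k - 1)) + card (lex_family n T k) = pair_size n k (lexval n T)"
proof -
  have "2 \<le> n"
    using T by fastforce
  have "lex_family n (partner T) (k - 1) = lex_family n (partner T \<inter> {2..n}) (k - 1)"
    by (simp add: lex_family_def)
  also have "\<dots> = {A \<in> nsets {2..n} (k - 1). lexval n (partner T \<inter> {2..n}) \<le> lexval n A}"
    by (rule lex_family_eq) auto
  also have "\<dots> = {A \<in> nsets {2..n} (k - 1). lexval n ({2..n} - A) < lexval n T}"
  proof (rule Collect_cong, rule conj_cong[OF refl])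
    fix A assume "A \<in> nsets {2..n} (k - 1)"
    then have "lexval n A + lexval n ({2..n} - A) + 1 = 2 ^ (n - 1)"
      using \<open>2 \<le> n\<close> by (intro lexval_complement) (auto simp: nsets_def)
    then show "(lexval n (partner T \<inter> {2..n}) \<le> lexval n A) = (lexval n ({2..n} - A) < lexval n T)"
      using lexval_partner[OF T] by linarith
  qed
  finally show ?thesis
    using T by (simp add: lex_family_eq pair_size_def)
qed

text \<open>The exceptional pair \<open>{1, 4}\<close>, \<open>{2, 3, 4}\<close> follows the partner
  rule too, so \<open>T\<close> alone determines a resistant pair.\<close>

lemma resistant_pairD:
  assumes "resistant_pair n k S T" "3 \<le> k"
  shows "T \<subseteq> {2..n}" "T \<noteq> {}" "S = partner T" "card T \<le> k"
proof -
  show "T \<subseteq> {2..n}" "T \<noteq> {}" "card T \<le> k"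
    using assms by (auto simp: resistant_pair_def)
  have *: "{1..4} = {1, 2, 3, 4::nat}"
    by auto
  show "S = partner T"
  proof (cases "T = {2, 3, 4} \<and> S = {1, 4}")
    case True
    then show ?thesis
      by (auto simp: partner_def *)
  next
    case False
    then have "S \<inter> T = {Max T}" "S \<union> T = {1..Max T}"
      using assms by (auto simp: resistant_pair_def)
    then show ?thesis
      unfolding partner_def by blast
  qed
qed

definition resistant :: "nat \<Rightarrow> nat \<Rightarrow> nat set \<Rightarrow> bool" where
  "resistant n k T \<longleftrightarrow> (\<exists>S. resistant_pair n k S T)"

lemma resistantE:
  assumes "resistant n k T" "T \<noteq> {2, 3, 4}"
  obtains S where "S \<inter> T = {Max T}" "S \<union> T = {1..Max T}" "T \<subseteq> {2..n}" "T \<noteq> {}"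
    "\<And>i. 4 \<le> i \<Longrightarrow> card ({1..i} \<inter> S) < card ({1..i} - S)"
  using assms unfolding resistant_def resistant_pair_def by blast

lemma card_interval_split: "card ({1..i} \<inter> S) + card ({1..i} - S) = (i::nat)"
  using card_Int_Diff[of "{1..i}" S] by simp

text \<open>Below \<open>Max T\<close> the sets \<open>S\<close> and \<open>T\<close> are
  complementary in \<open>{1..i}\<close>, so the counting condition says that \<open>T\<close> holds
  more than half of it.\<close>

lemma resistant_prefix_balance:
  assumes "resistant n k T" "T \<noteq> {2, 3, 4}" "4 \<le> i" "i < Max T"
  shows "i < 2 * card (T \<inter> {..i})"
proof -
  obtain S where S: "S \<inter> T = {Max T}" "S \<union> T = {1..Max T}" "T \<subseteq> {2..n}"
    and less: "card ({1..i} \<inter> S) < card ({1..i} - S)"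
    using resistantE[OF assms(1,2)] assms(3) by metis
  have "{1..i} - S = T \<inter> {..i}"
  proof (rule set_eqI)
    fix x
    have "x \<in> S \<union> T \<longleftrightarrow> 1 \<le> x \<and> x \<le> Max T"
      unfolding S(2) by simp
    moreover have "x \<in> S \<inter> T \<longleftrightarrow> x = Max T"
      unfolding S(1) by simp
    ultimately show "x \<in> {1..i} - S \<longleftrightarrow> x \<in> T \<inter> {..i}"
      using assms(4) by auto
  qed
  moreover have "card ({1..i} \<inter> S) + card ({1..i} - S) = i"
      by (rule card_interval_split)
  ultimately show ?thesis
    using less by simp
qed

text \<open>At \<open>Max T\<close> the common element counts for \<open>S\<close>, which leaves
  only \<open>card T - 1\<close> elements outside \<open>S\<close>.\<close>

lemma resistant_Max_balance:
  assumes "resistant n k T" "T \<noteq> {2, 3, 4}" "4 \<le> Max T"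
  shows "Max T + 2 < 2 * card T"
proof -
  obtain S where S: "S \<inter> T = {Max T}" "S \<union> T = {1..Max T}" "T \<subseteq> {2..n}" "T \<noteq> {}"
    and less: "card ({1..Max T} \<inter> S) < card ({1..Max T} - S)"
    using resistantE[OF assms(1,2)] assms(3) by metis
  have "{1..Max T} - S = T - {Max T}"
    using S by blast
  moreover have "card ({1..Max T} \<inter> S) + card ({1..Max T} - S) = Max T"
      by (rule card_interval_split)
  moreover have "finite T"
    using S(3) finite_subset by blast
  ultimately show ?thesis
    using less S by (simp add: card_Diff_singleton)
qed

text \<open>At \<open>i = 4\<close> at most one element may lie in \<open>S\<close>, and 1 takes
  that place. Hence all resistant values lie in one dyadic block, the root of the recursion.\<close>

lemma resistant_prefix_four:
  assumes res: "resistant n k T" and k: "3 \<le> k"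
  shows "T \<inter> {..4} = {2, 3, 4}"
proof (cases "T = {2, 3, 4}")
  case False
  obtain S where S: "S \<inter> T = {Max T}" "S \<union> T = {1..Max T}" "T \<subseteq> {2..n}" "T \<noteq> {}"
    and less: "card ({1..4} \<inter> S) < card ({1..4} - S)"
    using resistantE[OF assms(1) False] by (metis order_refl)
  have "card ({1..4} \<inter> S) + card ({1..4} - S) = (4::nat)"
      by (rule card_interval_split)
  with less have "card ({1..4} \<inter> S) \<le> 1"
    by simp
  moreover have "finite T"
    using S finite_subset by blast
  then have j: "Max T \<in> T" "2 \<le> Max T"
    using S by (auto dest: Max_in)
  then have "1 \<in> S \<union> T" "1 \<notin> T"
    using S by auto
  then have "1 \<in> {1..4} \<inter> S"
    by simp
  ultimately have eq: "{1..4} \<inter> S = {1}"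
    using card_seteq[of "{1..4} \<inter> S" "{1}"] by simp
  have "4 < Max T"
  proof (rule ccontr)
    assume "\<not> 4 < Max T"
    then have "Max T \<in> {1..4} \<inter> S"
      using S(1) j by auto
    then show False
      unfolding eq using j by simp
  qed
  show ?thesis
  proof (rule set_eqI)
    fix x
    have "x \<in> T \<longleftrightarrow> x \<in> {2, 3, 4}" if "x \<le> 4"
    proof -
      have "x \<in> {1..4} \<inter> S \<longleftrightarrow> x = 1"
        unfolding eq by simp
      moreover have "x \<in> S \<union> T \<longleftrightarrow> 1 \<le> x"
        unfolding S(2) using that \<open>4 < Max T\<close> by simp
      moreover have "x \<notin> S \<inter> T"
        unfolding S(1) using that \<open>4 < Max T\<close> by simp
      moreover have "x \<in> T \<Longrightarrow> 2 \<le> x"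
        using S(3) by auto
      ultimately show ?thesis
        using that by auto
    qed
    then show "x \<in> T \<inter> {..4} \<longleftrightarrow> x \<in> {2, 3, 4}"
      by auto
  qed
qed auto

text \<open>Up to \<open>i\<close> the counting condition is the balance of \<open>P\<close>. Beyond
  \<open>i\<close>, the partner has \<open>i - card P + 1\<close> elements in all, at most half of
  \<open>i\<close> by the surplus of two.\<close>

lemma resistant_insert:
  assumes P: "P \<subseteq> {2..i}" and i: "4 \<le> i" "i < n" and k: "card P < k" and d: "i + 2 \<le> 2 * card P"
    and balance: "\<And>i'. 4 \<le> i' \<Longrightarrow> i' \<le> i \<Longrightarrow> i' < 2 * card (P \<inter> {..i'})"
  shows "resistant n k (insert (Suc i) P)"
proof -
  let ?T = "insert (Suc i) P" and ?S = "insert (Suc i) ({1..i} - P)"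
  have finP: "finite P" and ni: "Suc i \<notin> P" and P1: "P \<subseteq> {1..i}"
    using P finite_subset by auto
  then have Max: "Max ?T = Suc i"
    using P by (intro Max_eqI) auto
  have cS: "card ?S = i - card P + 1"
    using P1 finP by (simp add: card_Diff_subset)
  have "card P \<le> i"
    using card_mono[OF _ P1] by simp
  have "card ({1..i'} \<inter> ?S) < card ({1..i'} - ?S)" if "4 \<le> i'" for i'
  proof -
    have sum: "card ({1..i'} \<inter> ?S) + card ({1..i'} - ?S) = i'"
      by (rule card_interval_split)
    show ?thesis
    proof (cases "i' \<le> i")
      case True
      then have "{1..i'} - ?S = P \<inter> {..i'}"
        using P1 by auto
      then show ?thesis
        using sum balance[OF that True] by simp
    next
      case False
      have "card ({1..i'} \<inter> ?S) \<le> card ?S"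
        by (rule card_mono) auto
      then show ?thesis
        using sum cS d False \<open>card P \<le> i\<close> by simp
    qed
  qed
  moreover have "?S \<inter> ?T = {Suc i}" "?S \<union> ?T = {1..Suc i}"
    using P1 ni by auto
  moreover have "card ?S \<le> k" "card ?T \<le> k"
    using cS d k ni finP by auto
  moreover have "?S \<subseteq> {1..n}" "?T \<subseteq> {2..n}"
    using P i by auto
  ultimately have "resistant_pair n k ?S ?T"
    unfolding resistant_pair_def Max by blast
  then show ?thesis
    by (auto simp: resistant_def)
qed

(* P is included even if it is not resistant: its value is the end of the block with trace P. *)
definition block_values :: "nat \<Rightarrow> nat \<Rightarrow> nat \<Rightarrow> nat set \<Rightarrow> nat set" where
  "block_values n k i P = lexval n ` insert P {T. resistant n k T \<and> T \<inter> {..i} = P}"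

lemma block_values_bounds:
  assumes "y \<in> block_values n k i P" "P \<subseteq> {2..i}" "i \<le> n" "3 \<le> k"
  shows "lexval n P \<le> y" "y < lexval n P + 2 ^ (n - i)"
proof -
  obtain T where T: "y = lexval n T" "T = P \<or> resistant n k T \<and> T \<inter> {..i} = P"
    using assms(1) by (auto simp: block_values_def)
  have "T \<subseteq> {2..n}"
    using T(2)
  proof
    assume "T = P"
    then show ?thesis
      using assms(2,3) by auto
  next
    assume "resistant n k T \<and> T \<inter> {..i} = P"
    then show ?thesis
      using resistant_pairD(1) assms(4) unfolding resistant_def by blast
  qed
  moreover have "P \<subseteq> {..i}"
    using assms(2) by auto
  ultimately have "T \<subseteq> {..n}" "T \<inter> {..i} = P" "P \<subseteq> {..i}"
    using T(2) by auto
  then show "lexval n P \<le> y" "y < lexval n P + 2 ^ (n - i)"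
    using lexval_prefix_iff[of T n P i] assms T by auto
qed

section \<open>Recursive splitting of dyadic blocks\<close>

lemma Int_atMost_Suc: "X \<inter> {..Suc i} = (if Suc i \<in> X then insert (Suc i) (X \<inter> {..i}) else X \<inter> {..i})"
  by (auto simp: le_Suc_eq)

lemma one_less_binomial:
  assumes "0 < r" "r < m"
  shows "1 < m choose r"
proof -
  obtain r' m' where eq: "r = Suc r'" "m = Suc m'"
    using assms by (metis gr0_implies_Suc less_trans)
  then have "0 < m' choose r'" "0 < m' choose Suc r'"
    using assms by auto
  then show ?thesis
    unfolding eq binomial_Suc_Suc by linarith
qed

text \<open>Recursion over blocks with positive surplus \<open>2 * card P - i\<close>: the listed
  values are strict records, and each k-set of the block is dominated by a record at or below its
  value. The right end of the block is part of the first claim so that adjacent blocks can be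
  joined.\<close>

lemma pair_size_block_values:
  assumes "P \<subseteq> {2..i}" "4 \<le> i" "card P \<le> k" and k: "3 \<le> k" "2 * k < n"
    and "\<And>i'. 4 \<le> i' \<Longrightarrow> i' \<le> i \<Longrightarrow> i' < 2 * card (P \<inter> {..i'})"
  shows "(\<forall>x\<in>insert (lexval n P + 2 ^ (n - i)) (block_values n k i P). \<forall>y\<in>block_values n k i P.
        y < x \<longrightarrow> pair_size n k y < pair_size n k x) \<and>
      (\<forall>B\<in>nsets {2..n} k. B \<inter> {..i} = P \<longrightarrow>
        (\<exists>y\<in>block_values n k i P. y \<le> lexval n B \<and> pair_size n k (lexval n B) \<le> pair_size n k y))"
  using assms(1-3,6)
\<comment> \<open>Positive surplus gives \<open>i < 2 * card P \<le> 2 * k\<close>, so the measure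
  drops with each split.\<close>
proof (induction "2 * k - i" arbitrary: i P rule: less_induct)
  case less
  have P: "P \<subseteq> {2..i}" and i: "4 \<le> i" and cP: "card P \<le> k"
    and balance: "\<And>i'. 4 \<le> i' \<Longrightarrow> i' \<le> i \<Longrightarrow> i' < 2 * card (P \<inter> {..i'})"
    using less.prems by auto
  have finP: "finite P" and Pi: "P \<inter> {..i} = P" and ni: "Suc i \<notin> P"
    using P finite_subset by auto
  have d: "i < 2 * card P"
    using balance[of i] i Pi by simp
  then have "i < n"
    using cP k by simp
  note block = pair_size_block[OF P _ less_imp_le[OF \<open>i < n\<close>] _ k(2) cP]
  show ?case
  proof (cases "card P = k")
    case True
    have TP: "T = P" if "P \<subseteq> T" "finite T" "card T \<le> k" for T
      using that True by (metis card_seteq)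
    have "T = P" if "resistant n k T" "T \<inter> {..i} = P" for T
      using that resistant_pairD[of n k _ T] k
      by (intro TP) (auto simp: resistant_def intro: finite_subset)
    then have "insert P {T. resistant n k T \<and> T \<inter> {..i} = P} = {P}"
      by blast
    then have "block_values n k i P = lexval n ` {P}"
      by (simp only: block_values_def)
    then have vals: "block_values n k i P = {lexval n P}"
      by simp
    \<comment> \<open>\<open>P\<close> is the only k-set of the block, so the gain is 1; the loss is
      \<open>(n - i) choose (n - 2 * k)\<close>, with \<open>0 < n - 2 * k < n - i\<close>.\<close>
    have "1 < (n - i) choose (n - k - card P)"
      by (rule one_less_binomial) (use True d k \<open>i < n\<close> in auto)
    then have "pair_size n k (lexval n P) < pair_size n k (lexval n P + 2 ^ (n - i))"
      using block i k True by simp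
    moreover have "B = P" if "B \<in> nsets {2..n} k" "B \<inter> {..i} = P" for B
      using that by (intro TP) (auto simp: nsets_def)
    then have "\<forall>B\<in>nsets {2..n} k. B \<inter> {..i} = P \<longrightarrow>
        (\<exists>y\<in>{lexval n P}. y \<le> lexval n B \<and> pair_size n k (lexval n B) \<le> pair_size n k y)"
      by (metis order_refl singletonI)
    ultimately show ?thesis
      unfolding vals by simp
  next
    case False
    then have cP': "card P < k"
      using cP by simp
    \<comment> \<open>On \<open>{..Suc i}\<close> the upper half of the block has trace
      \<open>?Q\<close> and the lower half has trace \<open>P\<close>; \<open>lexval n ?Q\<close> is
      the boundary.\<close>
    let ?Q = "insert (Suc i) P"
    have trim: "T \<inter> {..i} = (T \<inter> {..Suc i}) - {Suc i}" for T
      by auto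
    have Q: "?Q \<subseteq> {2..Suc i}" and P': "P \<subseteq> {2..Suc i}"
      using P i by auto
    have pow: "2 ^ (n - i) = 2 ^ (n - Suc i) + (2::nat) ^ (n - Suc i)"
      using \<open>i < n\<close> by (metis Suc_diff_Suc mult_2 power_Suc)
    have valQ: "lexval n ?Q = lexval n P + 2 ^ (n - Suc i)"
      using finP ni by (simp add: lexval_def)
    have startQ: "lexval n ?Q + 2 ^ (n - Suc i) = lexval n P + 2 ^ (n - i)"
      using valQ pow by simp
    have low: "i' < 2 * card (insert (Suc i) P \<inter> {..i'})" if "4 \<le> i'" "i' \<le> Suc i" for i'
    proof (cases "i' = Suc i")
      case True
      then have "insert (Suc i) P \<inter> {..i'} = ?Q"
        using P by auto
      then show ?thesis
        using True d finP ni by simp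
    next
      case False
      then have "insert (Suc i) P \<inter> {..i'} = P \<inter> {..i'}"
        using that by auto
      then show ?thesis
        using False that balance[of i'] by simp
    qed
    have decr: "2 * k - Suc i < 2 * k - i"
      using d cP by simp
    have IHQ: "(\<forall>x\<in>insert (lexval n P + 2 ^ (n - i)) (block_values n k (Suc i) ?Q).
          \<forall>y\<in>block_values n k (Suc i) ?Q. y < x \<longrightarrow> pair_size n k y < pair_size n k x) \<and>
        (\<forall>B\<in>nsets {2..n} k. B \<inter> {..Suc i} = ?Q \<longrightarrow> (\<exists>y\<in>block_values n k (Suc i) ?Q.
          y \<le> lexval n B \<and> pair_size n k (lexval n B) \<le> pair_size n k y))"
      unfolding startQ[symmetric]
      by (rule less.hyps[OF decr Q]) (use i cP' finP ni low in auto)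
    have boundsQ: "lexval n ?Q \<le> y" "y < lexval n P + 2 ^ (n - i)"
      if "y \<in> block_values n k (Suc i) ?Q" for y
      using block_values_bounds[OF that Q _ k(1)] \<open>i < n\<close> startQ by auto
    have Q_in: "lexval n ?Q \<in> block_values n k (Suc i) ?Q"
      by (simp add: block_values_def)
    show ?thesis
    \<comment> \<open>With surplus at least two, \<open>P\<close> stays balanced at
      \<open>Suc i\<close> and both halves recurse; with surplus one, only the upper half
      does.\<close>
    proof (cases "i + 2 \<le> 2 * card P")
      case True
      have resQ: "resistant n k ?Q"
        by (rule resistant_insert[OF P i \<open>i < n\<close> cP' True balance])
      have balP: "i' < 2 * card (P \<inter> {..i'})" if "4 \<le> i'" "i' \<le> Suc i" for i'
      proof (cases "i' = Suc i")
        case True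
        then have "P \<inter> {..i'} = P"
          using P by auto
        then show ?thesis
          using True \<open>i + 2 \<le> 2 * card P\<close> by simp
      qed (use that balance in auto)
      have IHP: "(\<forall>x\<in>insert (lexval n ?Q) (block_values n k (Suc i) P).
            \<forall>y\<in>block_values n k (Suc i) P. y < x \<longrightarrow> pair_size n k y < pair_size n k x) \<and>
          (\<forall>B\<in>nsets {2..n} k. B \<inter> {..Suc i} = P \<longrightarrow> (\<exists>y\<in>block_values n k (Suc i) P.
            y \<le> lexval n B \<and> pair_size n k (lexval n B) \<le> pair_size n k y))"
        unfolding valQ by (rule less.hyps[OF decr P']) (use i cP balP in auto)
      have boundsP: "lexval n P \<le> y" "y < lexval n ?Q"
        if "y \<in> block_values n k (Suc i) P" for y
        using block_values_bounds[OF that P' _ k(1)] \<open>i < n\<close> valQ by auto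
      have vals: "block_values n k i P = block_values n k (Suc i) ?Q \<union> block_values n k (Suc i) P"
      proof -
        have "T \<inter> {..i} = P \<longleftrightarrow> T \<inter> {..Suc i} = ?Q \<or> T \<inter> {..Suc i} = P" for T
        proof
          assume "T \<inter> {..i} = P"
          then show "T \<inter> {..Suc i} = ?Q \<or> T \<inter> {..Suc i} = P"
            by (simp add: Int_atMost_Suc)
        next
          assume "T \<inter> {..Suc i} = ?Q \<or> T \<inter> {..Suc i} = P"
          then show "T \<inter> {..i} = P"
            unfolding trim[of T] using ni by auto
        qed
        moreover have "?Q \<inter> {..i} = P"
          using P by auto
        ultimately show ?thesis
          using resQ by (auto simp: block_values_def)
      qed
      show ?thesis
      proof (intro conjI ballI impI)
        fix x y
        assume x: "x \<in> insert (lexval n P + 2 ^ (n - i)) (block_values n k i P)"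
          and y: "y \<in> block_values n k i P" and less: "y < x"
        show "pair_size n k y < pair_size n k x"
        proof (cases "y \<in> block_values n k (Suc i) ?Q")
          case True
          then have "x \<notin> block_values n k (Suc i) P"
            using boundsQ boundsP less by fastforce
          then show ?thesis
            using IHQ x True less vals by blast
        next
          case False
          then have yP: "y \<in> block_values n k (Suc i) P"
            using y vals by blast
          show ?thesis
          proof (cases "x \<in> block_values n k (Suc i) P")
            case True
            then show ?thesis
              using IHP yP less by blast
          next
            case False
            then have xQ: "x \<in> insert (lexval n P + 2 ^ (n - i)) (block_values n k (Suc i) ?Q)"
              using x vals by blast
            \<comment> \<open>The boundary is a record of the upper half and the right end of the
              lower half, so it links the two.\<close>
            then have "lexval n ?Q \<le> x"
              using boundsQ startQ by auto
            then have "pair_size n k (lexval n ?Q) \<le> pair_size n k x"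
              using IHQ xQ Q_in by (cases "lexval n ?Q = x") (auto simp: le_less)
            moreover have "pair_size n k y < pair_size n k (lexval n ?Q)"
              using IHP yP boundsP(2)[OF yP] by blast
            ultimately show ?thesis
              by simp
          qed
        qed
      next
        fix B assume B: "B \<in> nsets {2..n} k" "B \<inter> {..i} = P"
        then have "B \<inter> {..Suc i} = ?Q \<or> B \<inter> {..Suc i} = P"
          by (auto simp: Int_atMost_Suc)
        then have "(\<exists>y\<in>block_values n k (Suc i) ?Q.
              y \<le> lexval n B \<and> pair_size n k (lexval n B) \<le> pair_size n k y) \<or>
            (\<exists>y\<in>block_values n k (Suc i) P.
              y \<le> lexval n B \<and> pair_size n k (lexval n B) \<le> pair_size n k y)"
          using IHQ[THEN conjunct2, rule_format, OF B(1)] IHP[THEN conjunct2, rule_format, OF B(1)]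
          by (elim disjE) simp_all
        then show "\<exists>y\<in>block_values n k i P. y \<le> lexval n B \<and> pair_size n k (lexval n B) \<le> pair_size n k y"
          unfolding vals bex_Un .
      qed
    next
      case False
      then have d1: "Suc i = 2 * card P"
        using d by simp
      \<comment> \<open>A set omitting \<open>Suc i\<close> would violate the prefix balance there,
        and \<open>?Q\<close> just misses the strict inequality at its maximum. So apart from
        \<open>P\<close>, only resistant sets of the upper half other than \<open>?Q\<close>
        remain.\<close>
      have resT: "T \<inter> {..Suc i} = ?Q \<and> T \<noteq> ?Q"
        if T: "resistant n k T" "T \<inter> {..i} = P" "T \<noteq> P" for T
      proof -
        obtain S where "resistant_pair n k S T"
          using T by (auto simp: resistant_def)
        then have Tn: "T \<subseteq> {2..n}" "T \<noteq> {}"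
          using resistant_pairD[OF _ k(1)] by auto
        then have finT: "finite T"
          using finite_subset by blast
        have "T \<noteq> {2, 3, 4}"
          using T i by auto
        have "i < Max T"
        proof (rule ccontr)
          assume "\<not> i < Max T"
          then have "T \<subseteq> {..i}"
            using finT by (metis Max_ge atMost_iff linorder_not_less order_trans subsetI)
          then show False
            using T by blast
        qed
        have "Suc i \<in> T"
        proof (rule ccontr)
          assume *: "Suc i \<notin> T"
          then have "Suc i < Max T"
            using \<open>i < Max T\<close> Max_in[OF finT Tn(2)] by (metis Suc_lessI)
          then have "Suc i < 2 * card (T \<inter> {..Suc i})"
            using resistant_prefix_balance[OF T(1) \<open>T \<noteq> {2, 3, 4}\<close>, of "Suc i"] i by simp
          moreover have "T \<inter> {..Suc i} = P"
            using * T(2) by (simp add: Int_atMost_Suc)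
          ultimately show False
            using d1 by simp
        qed
        moreover have "T \<noteq> ?Q"
        proof
          assume "T = ?Q"
          moreover have "Max ?Q = Suc i"
            using P finP by (intro Max_eqI) auto
          ultimately have "Suc i + 2 < 2 * card ?Q"
            using resistant_Max_balance[OF T(1) \<open>T \<noteq> {2, 3, 4}\<close>] i by simp
          then show False
            using d1 finP ni by simp
        qed
        ultimately show ?thesis
          using T by (simp add: Int_atMost_Suc)
      qed
      \<comment> \<open>Dropping \<open>Suc i\<close> gives a balanced block, so \<open>?Q\<close> and \<open>P\<close> tie and the record at \<open>?Q\<close> passes to \<open>P\<close>.\<close>
      have vals: "block_values n k i P
        = insert (lexval n P) (block_values n k (Suc i) ?Q - {lexval n ?Q})"
      proof
        show "block_values n k i P \<subseteq> insert (lexval n P) (block_values n k (Suc i) ?Q - {lexval n ?Q})"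
        proof
          fix y assume "y \<in> block_values n k i P"
          then obtain T where T: "y = lexval n T" "T = P \<or> resistant n k T \<and> T \<inter> {..i} = P"
            by (auto simp: block_values_def)
          show "y \<in> insert (lexval n P) (block_values n k (Suc i) ?Q - {lexval n ?Q})"
          proof (cases "T = P")
            case False
            then have *: "resistant n k T" "T \<inter> {..Suc i} = ?Q" "T \<noteq> ?Q"
              using T resT by auto
            then have "T \<subseteq> {..n}" "?Q \<subseteq> {..n}"
              using resistant_pairD(1)[OF _ k(1)] P \<open>i < n\<close> by (fastforce simp: resistant_def)+
            then have "y \<noteq> lexval n ?Q"
              using T(1) *(3) lexval_inject by blast
            then show ?thesis
              using T * by (auto simp: block_values_def)
          qed (use T in simp)
        qed
        have "T \<inter> {..i} = P" if "T \<inter> {..Suc i} = ?Q" for T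
          unfolding trim[of T] that using ni by simp
        then show "insert (lexval n P) (block_values n k (Suc i) ?Q - {lexval n ?Q}) \<subseteq> block_values n k i P"
          by (auto simp: block_values_def)
      qed
      \<comment> \<open>As \<open>Suc i = 2 * card P\<close>, the two lower indices add up to
        \<open>n - Suc i\<close>.\<close>
      have "(n - Suc i) choose (n - k - card P) = (n - Suc i) choose (k - card P)"
        using d1 k cP by (subst binomial_symmetric) (auto intro!: arg_cong[where f = "(choose) _"])
      then have eq: "pair_size n k (lexval n P) = pair_size n k (lexval n ?Q)"
        using pair_size_block[OF P' _ _ _ k(2) cP] k \<open>i < n\<close> valQ by simp
      show ?thesis
      proof (intro conjI ballI impI)
        fix x y
        assume x: "x \<in> insert (lexval n P + 2 ^ (n - i)) (block_values n k i P)"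
          and y: "y \<in> block_values n k i P" and less: "y < x"
        have "lexval n P \<le> y"
          using block_values_bounds(1)[OF y P _ k(1)] \<open>i < n\<close> by simp
        then have "x \<noteq> lexval n P"
          using less by simp
        moreover have "lexval n ?Q < lexval n P + 2 ^ (n - i)"
          unfolding startQ[symmetric] by simp
        moreover have "x = lexval n P + 2 ^ (n - i) \<or> x \<in> block_values n k (Suc i) ?Q - {lexval n ?Q}"
          using x \<open>x \<noteq> lexval n P\<close> unfolding vals by blast
        ultimately have xQ: "x \<in> insert (lexval n P + 2 ^ (n - i)) (block_values n k (Suc i) ?Q)"
          and "lexval n ?Q < x"
          using boundsQ(1)[of x] by (auto simp: le_less)
        show "pair_size n k y < pair_size n k x"
        proof (cases "y = lexval n P")
          case True
          show ?thesis
            unfolding True eq by (rule IHQ[THEN conjunct1, rule_format, OF xQ Q_in \<open>lexval n ?Q < x\<close>])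
        next
          case False
          then have "y \<in> block_values n k (Suc i) ?Q"
            using y unfolding vals by blast
          then show ?thesis
            by (rule IHQ[THEN conjunct1, rule_format, OF xQ _ less])
        qed
      next
        fix B assume B: "B \<in> nsets {2..n} k" "B \<inter> {..i} = P"
        then have Bn: "B \<subseteq> {..n}"
          by (auto simp: nsets_def)
        show "\<exists>y\<in>block_values n k i P. y \<le> lexval n B \<and> pair_size n k (lexval n B) \<le> pair_size n k y"
        proof (cases "Suc i \<in> B")
          case True
          then have "B \<inter> {..Suc i} = ?Q"
            using B by (simp add: Int_atMost_Suc)
          then obtain y where y: "y \<in> block_values n k (Suc i) ?Q" "y \<le> lexval n B"
            "pair_size n k (lexval n B) \<le> pair_size n k y"
            using IHQ[THEN conjunct2, rule_format, OF B(1)] by blast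
          show ?thesis
          proof (cases "y = lexval n ?Q")
            case True
            then show ?thesis
              using y eq vals valQ by (intro bexI[of _ "lexval n P"]) auto
          qed (use y vals in blast)
        next
          case False
          then have "B \<inter> {..Suc i} = P"
            using B by (simp add: Int_atMost_Suc)
          then have *: "lexval n P \<le> lexval n B" "lexval n B < lexval n P + 2 ^ (n - Suc i)"
            using lexval_prefix_iff[OF Bn, of P "Suc i"] P' \<open>i < n\<close> by auto
          then have "pair_size n k (lexval n B) \<le> pair_size n k (lexval n P)"
            using d1 k cP by (intro pair_size_balanced_block[OF P']) auto
          then show ?thesis
            using * vals by blast
        qed
      qed
    qed
  qed
qed

section \<open>From intersecting families to cross-intersecting pairs, and the conclusion\<close>

section \<open>Intersecting families\<close>

lemma strict_antimono_upto:
  fixes f :: "nat \<Rightarrow> 'a::order"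
  assumes "\<And>l. l < m \<Longrightarrow> f (Suc l) < f l" "i < j" "j \<le> m"
  shows "f j < f i"
  using assms(2,3)
proof (induction j)
  case (Suc j)
  then show ?case
    using assms(1)[of j] by (cases "i = j") (auto intro: less_trans)
qed simp

text \<open>A vertex \<open>v\<close> of maximal degree is exchanged with 1. The sets through
  \<open>v\<close>, stripped of \<open>v\<close>, give \<open>\<A>\<close>; the others, whose number
  is the diversity, give \<open>\<B>\<close>. The latter avoid \<open>v\<close>, so they meet the
  former in other points.\<close>

lemma intersecting_cross_intersecting:
  assumes \<F>: "\<F> \<subseteq> nsets {1..n} k" "intersecting \<F>" and n: "1 \<le> n"
  obtains \<A> \<B> where "\<A> \<subseteq> nsets {2..n} (k - 1)" "\<B> \<subseteq> nsets {2..n} k" "cross_intersecting \<A> \<B>"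
    "card \<B> = diversity n \<F>" "card \<F> = card \<A> + card \<B>"
proof -
  have fin: "finite \<F>"
    using \<F> finite_imp_finite_nsets[of "{1..n}" k] finite_subset by auto
  have "max_degree n \<F> \<in> (\<lambda>x. card {F \<in> \<F>. x \<in> F}) ` {1..n}"
    unfolding max_degree_def using n by (intro Max_in) auto
  then obtain v where v: "v \<in> {1..n}" "max_degree n \<F> = card {F \<in> \<F>. v \<in> F}"
    by blast
  define \<pi> where "\<pi> x = (if x = 1 then v else if x = v then 1 else x)" for x
  have inv: "\<pi> (\<pi> x) = x" for x
    by (simp add: \<pi>_def)
  have inj: "inj \<pi>"
    by (metis inv injI)
  have moved: "\<pi> x \<in> {2..n}" if "x \<in> {1..n}" "x \<noteq> v" for x
    using that v(1) by (auto simp: \<pi>_def)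
  define \<F>1 where "\<F>1 = {F \<in> \<F>. v \<in> F}"
  define \<F>0 where "\<F>0 = {F \<in> \<F>. v \<notin> F}"
  define \<A> where "\<A> = (\<lambda>F. \<pi> ` (F - {v})) ` \<F>1"
  define \<B> where "\<B> = (\<lambda>F. \<pi> ` F) ` \<F>0"
  have "inj_on (\<lambda>F. \<pi> ` (F - {v})) \<F>1"
  proof (rule inj_onI)
    fix F G assume "F \<in> \<F>1" "G \<in> \<F>1" "\<pi> ` (F - {v}) = \<pi> ` (G - {v})"
    then have "F - {v} = G - {v}" "v \<in> F" "v \<in> G"
      using inj by (auto simp: inj_image_eq_iff \<F>1_def)
    then show "F = G"
      by blast
  qed
  then have cA: "card \<A> = card \<F>1"
    by (simp add: \<A>_def card_image)
  have "inj_on (\<lambda>F. \<pi> ` F) \<F>0"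
    using inj by (auto simp: inj_on_def inj_image_eq_iff)
  then have cB: "card \<B> = card \<F>0"
    by (simp add: \<B>_def card_image)
  have "card \<F> = card (\<F>1 \<union> \<F>0)"
    by (rule arg_cong[where f = card]) (auto simp: \<F>1_def \<F>0_def)
  also have "\<dots> = card \<F>1 + card \<F>0"
    using fin by (intro card_Un_disjoint) (auto simp: \<F>1_def \<F>0_def)
  finally have cF: "card \<F> = card \<A> + card \<B>"
    using cA cB by simp
  moreover have "card \<B> = diversity n \<F>"
    using cF cA v by (simp add: diversity_def \<F>1_def)
  moreover have "\<A> \<subseteq> nsets {2..n} (k - 1)"
  proof
    fix A assume "A \<in> \<A>"
    then obtain F where F: "F \<in> \<F>" "v \<in> F" "A = \<pi> ` (F - {v})"
      by (auto simp: \<A>_def \<F>1_def)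
    then have F': "F \<subseteq> {1..n}" "finite F" "card F = k"
      using \<F> by (auto simp: nsets_def)
    have "card A = k - 1"
      using F F' inj_on_subset[OF inj subset_UNIV] by (simp add: card_image)
    moreover have "A \<subseteq> {2..n}"
      unfolding F(3) using moved F(2) F'(1) by blast
    ultimately show "A \<in> nsets {2..n} (k - 1)"
      using F F' by (simp add: nsets_def)
  qed
  moreover have "\<B> \<subseteq> nsets {2..n} k"
  proof
    fix B assume "B \<in> \<B>"
    then obtain F where F: "F \<in> \<F>" "v \<notin> F" "B = \<pi> ` F"
      by (auto simp: \<B>_def \<F>0_def)
    then have F': "F \<subseteq> {1..n}" "finite F" "card F = k"
      using \<F> by (auto simp: nsets_def)
    have "card B = k"
      using F F' inj_on_subset[OF inj subset_UNIV] by (simp add: card_image)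
    moreover have "B \<subseteq> {2..n}"
      unfolding F(3) using moved F(2) F'(1) by blast
    ultimately show "B \<in> nsets {2..n} k"
      using F F' by (simp add: nsets_def)
  qed
  moreover have "cross_intersecting \<A> \<B>"
    unfolding cross_intersecting_def
  proof (intro ballI)
    fix A B assume "A \<in> \<A>" "B \<in> \<B>"
    then obtain F G where "F \<in> \<F>" "A = \<pi> ` (F - {v})" "G \<in> \<F>" "v \<notin> G" "B = \<pi> ` G"
      by (auto simp: \<A>_def \<B>_def \<F>0_def \<F>1_def)
    moreover from this obtain x where "x \<in> F" "x \<in> G"
      using \<F>(2) unfolding intersecting_def by blast
    ultimately show "A \<inter> B \<noteq> {}"
      by blast
  qed
  ultimately show ?thesis
    using that by blast
qed

lemma resistant_234: "4 \<le> n \<Longrightarrow> resistant n k {2, 3, 4}"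
  unfolding resistant_def by (rule exI[of _ "{1, 4}"]) (simp add: resistant_pair_def)

text \<open>Among subsets of the ground set only the whole has the value
  \<open>2 ^ (n - 1) - 1\<close>, and k-sets and (n-k)-sets are smaller. So the threshold of
  \<open>T 0\<close> can be exchanged for the right end of the root block.\<close>

lemma pair_size_ground:
  assumes "2 \<le> k" "2 * k < n"
  shows "pair_size n k (lexval n {2..n}) = pair_size n k (2 ^ (n - 1))"
proof -
  have empty: "{D \<in> nsets {2..n} r. lexval n {2..n} \<le> lexval n D \<and> lexval n D < 2 ^ (n - 1)} = {}"
    if "r < n - 1" for r
  proof -
    have "lexval n D < lexval n {2..n}" if D: "D \<in> nsets {2..n} r" for D
    proof -
      have D': "D \<subseteq> {2..n}" "card D = r"
        using D by (auto simp: nsets_def)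
      then have "D \<noteq> {2..n}"
        using \<open>r < n - 1\<close> by auto
      moreover have "D \<subseteq> {..n}" "{2..n} \<subseteq> {..n}"
        using D' by auto
      ultimately have "lexval n D \<noteq> lexval n {2..n}"
        using lexval_inject by blast
      moreover have "lexval n D \<le> lexval n {2..n}"
        using D' by (intro lexval_mono) auto
      ultimately show ?thesis
        by simp
    qed
    then show ?thesis
      using leD by blast
  qed
  have "lexval n {2..n} \<le> 2 ^ (n - 1)"
    using lexval_ground[of n] assms by simp
  moreover have "k < n - 1" "n - k < n - 1" "1 \<le> k" "k \<le> n"
    using assms by auto
  ultimately show ?thesis
    using pair_size_shift[of k n "lexval n {2..n}" "2 ^ (n - 1)"]
    by (simp only: empty card.empty add_0_right)
qed

theorem theorem19:
  fixes n k m :: nat and S T :: "nat \<Rightarrow> nat set"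
  assumes k: "6 \<le> 2 * k" and n: "2 * k < n"
    and T0: "T 0 = {2..n}" and S0: "S 0 = {1, n}"
    and all_resistant_pairs:
      "{(S l, T l) | l. l \<in> {1..m}} = {(S', T'). resistant_pair n k S' T'}"
    and strictly_increasing: "\<And>l. l < m \<Longrightarrow> lex_prec (T l) (T (Suc l)) \<and> T l \<noteq> T (Suc l)"
  shows
    "(\<forall>l\<in>{1..m}.
       card (lex_family n (S (l - 1)) (k - 1)) + card (lex_family n (T (l - 1)) k)
       > card (lex_family n (S l) (k - 1)) + card (lex_family n (T l) k))
     \<and>
     (\<forall>l\<in>{1..m}. \<forall>\<A> \<B>.
       \<A> \<subseteq> nsets {2..n} (k - 1) \<and> \<B> \<subseteq> nsets {2..n} k \<and> cross_intersecting \<A> \<B> \<and>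
       card (lex_family n (T (l - 1)) k) < card \<B> \<and> card \<B> \<le> card (lex_family n (T l) k) \<longrightarrow>
       card \<A> + card \<B> \<le> card (lex_family n (S l) (k - 1)) + card (lex_family n (T l) k))
     \<and>
     (\<forall>l\<in>{1..m}. \<forall>\<F>.
       \<F> \<subseteq> nsets {1..n} k \<and> intersecting \<F> \<and>
       card (lex_family n (T (l - 1)) k) < diversity n \<F> \<and>
       diversity n \<F> \<le> card (lex_family n (T l) k) \<longrightarrow>
       card \<F> \<le> card (lex_family n (S l) (k - 1)) + card (lex_family n (T l) k))"
proof -
  have k3: "3 \<le> k" and kn: "2 * k < n" and n: "6 < n"
    using k n by auto
  define c where "c l = lexval n (T l)" for l
  have pairs: "{(S', T'). resistant_pair n k S' T'} = (\<lambda>l. (S l, T l)) ` {1..m}"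
    unfolding all_resistant_pairs[symmetric] by blast
  have res: "resistant_pair n k (S l) (T l)" if "l \<in> {1..m}" for l
  proof -
    have "(S l, T l) \<in> {(S', T'). resistant_pair n k S' T'}"
      unfolding pairs using that by blast
    then show ?thesis
      by simp
  qed
  have T: "T l \<subseteq> {2..n}" "T l \<noteq> {}" if "l \<le> m" for l
    using that T0 n resistant_pairD(1,2)[OF res k3] by (cases "l = 0", auto)+
  have S: "S l = partner (T l)" if "l \<le> m" for l
  proof (cases "l = 0")
    case True
    have "Max {2..n} = n"
      using n by (intro Max_eqI) auto
    then show ?thesis
      using True S0 T0 n by (auto simp: partner_def)
  next
    case False
    then show ?thesis
      using resistant_pairD(3)[OF res k3] that by simp
  qed
  have size: "card (lex_family n (S l) (k - 1)) + card (lex_family n (T l) k) = pair_size n k (c l)"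
    if "l \<le> m" for l
    using pair_size_eq_card_lex_families[OF T[OF that]] S[OF that] by (simp add: c_def)
  have famT: "lex_family n (T l) k = {B \<in> nsets {2..n} k. c l \<le> lexval n B}" if "l \<le> m" for l
    using lex_family_eq T(1)[OF that] by (simp add: c_def)
  have c_less: "c j < c i" if "i < j" "j \<le> m" for i j
  proof (rule strict_antimono_upto[OF _ that])
    fix l assume l: "l < m"
    have sub: "T l \<subseteq> {..n}" "T (Suc l) \<subseteq> {..n}"
      using T(1)[of l] T(1)[of "Suc l"] l by auto
    then have "c (Suc l) \<le> c l" "c (Suc l) \<noteq> c l"
      using strictly_increasing[OF l] lex_prec_iff_lexval[OF sub] lexval_inject[OF sub]
      by (auto simp: c_def)
    then show "c (Suc l) < c l"
      by simp
  qed
  have resT: "{T'. resistant n k T'} = T ` {1..m}"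
  proof -
    have "{T'. resistant n k T'} = snd ` {(S', T'). resistant_pair n k S' T'}"
      by (force simp: resistant_def)
    then show ?thesis
      unfolding pairs by (simp add: image_image)
  qed
  let ?R = "{2, 3, 4::nat}"
  have "{T'. resistant n k T' \<and> T' \<inter> {..4} = ?R} = T ` {1..m}"
    using resistant_prefix_four[OF _ k3] resT by blast
  moreover have "?R \<in> T ` {1..m}"
    using resistant_234[of n k] n resT by auto
  ultimately have "insert ?R {T'. resistant n k T' \<and> T' \<inter> {..4} = ?R} = T ` {1..m}"
    by blast
  then have vals: "block_values n k 4 ?R = c ` {1..m}"
    unfolding block_values_def c_def by (simp add: image_image)
  have "?R \<union> {Suc 4..n} = {2..n}"
    using n by auto
  then have "lexval n {2..n} = lexval n ?R + lexval n {Suc 4..n}"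
    using lexval_Un_disjoint[of ?R "{Suc 4..n}" n] by simp
  \<comment> \<open>The block of \<open>?R\<close> is the topmost one: it ends one above the value
    of the ground set.\<close>
  then have start: "lexval n ?R + 2 ^ (n - 4) = 2 ^ (n - 1)"
    using lexval_tail[of 4 n] lexval_ground[of n] n by simp
  have "i' < 2 * card (?R \<inter> {..i'})" if "4 \<le> i'" "i' \<le> 4" for i'
  proof -
    have "i' = 4" "?R \<inter> {..4} = ?R"
      using that by auto
    then show ?thesis
      by simp
  qed
  then have root: "\<forall>x\<in>insert (2 ^ (n - 1)) (c ` {1..m}). \<forall>y\<in>c ` {1..m}.
        y < x \<longrightarrow> pair_size n k y < pair_size n k x"
      "\<forall>B\<in>nsets {2..n} k. B \<inter> {..4} = ?R \<longrightarrow>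
        (\<exists>y\<in>c ` {1..m}. y \<le> lexval n B \<and> pair_size n k (lexval n B) \<le> pair_size n k y)"
    using pair_size_block_values[of ?R 4 k n] k3 kn unfolding start vals by auto
  have c0: "pair_size n k (c 0) = pair_size n k (2 ^ (n - 1))" "c 0 + 1 = 2 ^ (n - 1)"
    using pair_size_ground[of k n] k3 kn T0 lexval_ground[of n] by (auto simp: c_def)
  have dec: "pair_size n k (c j) < pair_size n k (c i)" if "i < j" "j \<le> m" for i j
  proof (cases "i = 0")
    case True
    have "c j < 2 ^ (n - 1)"
      using c_less[of 0 j] that True c0 by simp
    then show ?thesis
      using root(1) that True c0 by simp
  next
    case False
    then show ?thesis
      using root(1) c_less[OF that] that by simp
  qed
  have cross: "card \<A> + card \<B> \<le> card (lex_family n (S l) (k - 1)) + card (lex_family n (T l) k)"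
    if l: "l \<in> {1..m}" and AB: "\<A> \<subseteq> nsets {2..n} (k - 1)" "\<B> \<subseteq> nsets {2..n} k" "cross_intersecting \<A> \<B>"
      and lower: "card (lex_family n (T (l - 1)) k) < card \<B>"
      and upper: "card \<B> \<le> card (lex_family n (T l) k)" for l \<A> \<B>
  proof -
    have lm: "l \<le> m" "l - 1 \<le> m"
      using l by auto
    have fin: "finite (nsets {2..n} k)"
      by (simp add: finite_imp_finite_nsets)
    have "\<B> \<noteq> {}"
      using lower by auto
    then obtain B where B: "B \<in> nsets {2..n} k" "card \<B> = card {C \<in> nsets {2..n} k. lexval n B \<le> lexval n C}"
      "card \<A> + card \<B> \<le> pair_size n k (lexval n B)"
      using cross_intersecting_card_le_pair_size[OF AB(1,2) _ AB(3) _ kn] k3 by force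
    \<comment> \<open>The bounds on \<open>card \<B>\<close> place the threshold between two
      consecutive terms of \<open>c\<close>.\<close>
    have "lexval n B < c (l - 1)"
    proof (rule ccontr)
      assume "\<not> lexval n B < c (l - 1)"
      then have "card \<B> \<le> card (lex_family n (T (l - 1)) k)"
        unfolding B famT[OF lm(2)] using fin by (intro card_mono) auto
      then show False
        using lower by simp
    qed
    have "c l \<le> lexval n B"
    proof (rule ccontr)
      assume "\<not> c l \<le> lexval n B"
      then have "lex_family n (T l) k \<subset> {C \<in> nsets {2..n} k. lexval n B \<le> lexval n C}"
        unfolding famT[OF lm(1)] using B(1) by auto
      then have "card (lex_family n (T l) k) < card \<B>"
        unfolding B using fin by (intro psubset_card_mono) auto
      then show False
        using upper by simp
    qed
    have "B \<subseteq> {..n}" "?R \<subseteq> {..4}"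
      using B(1) by (auto simp: nsets_def)
    moreover have "lexval n ?R \<le> c l"
      using block_values_bounds(1)[of "c l" n k 4 ?R] vals l n k3 by auto
    moreover have "lexval n B < 2 ^ (n - 1)"
    proof -
      have "lexval n B \<le> lexval n {2..n}"
        using B(1) by (intro lexval_mono) (auto simp: nsets_def)
      then show ?thesis
        using lexval_ground[of n] n by simp
    qed
    ultimately have "B \<inter> {..4} = ?R"
      using lexval_prefix_iff[of B n ?R 4] n start \<open>c l \<le> lexval n B\<close> by simp
    then obtain j where j: "j \<in> {1..m}" "c j \<le> lexval n B" "pair_size n k (lexval n B) \<le> pair_size n k (c j)"
      using root(2) B(1) by blast
    \<comment> \<open>The dominating record lies below \<open>c (l - 1)\<close>, so its index is at
      least \<open>l\<close>, and sizes fall as the index grows.\<close>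
    have "l \<le> j"
    proof (rule ccontr)
      assume "\<not> l \<le> j"
      then have "j = l - 1 \<or> j < l - 1"
        by linarith
      then have "c (l - 1) \<le> c j"
        using c_less[OF _ lm(2)] by (auto intro: less_imp_le)
      then show False
        using j \<open>lexval n B < c (l - 1)\<close> by simp
    qed
    then have "pair_size n k (c j) \<le> pair_size n k (c l)"
      using dec[of l j] j by (cases "l = j") auto
    then show ?thesis
      using B(3) j(3) size[OF lm(1)] by simp
  qed
  show ?thesis
  proof (intro conjI ballI allI impI)
    fix l assume l: "l \<in> {1..m}"
    then have "l - 1 < l" "l \<le> m" "l - 1 \<le> m"
      by auto
    then show "card (lex_family n (S l) (k - 1)) + card (lex_family n (T l) k)
        < card (lex_family n (S (l - 1)) (k - 1)) + card (lex_family n (T (l - 1)) k)"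
      using dec[of "l - 1" l] by (simp only: size)
  next
    fix l \<A> \<B>
    assume "l \<in> {1..m}"
      "\<A> \<subseteq> nsets {2..n} (k - 1) \<and> \<B> \<subseteq> nsets {2..n} k \<and> cross_intersecting \<A> \<B> \<and>
       card (lex_family n (T (l - 1)) k) < card \<B> \<and> card \<B> \<le> card (lex_family n (T l) k)"
    then show "card \<A> + card \<B> \<le> card (lex_family n (S l) (k - 1)) + card (lex_family n (T l) k)"
      using cross by blast
  next
    fix l \<F>
    assume l: "l \<in> {1..m}"
      and F: "\<F> \<subseteq> nsets {1..n} k \<and> intersecting \<F> \<and>
       card (lex_family n (T (l - 1)) k) < diversity n \<F> \<and>
       diversity n \<F> \<le> card (lex_family n (T l) k)"
    obtain \<A> \<B> where AB: "\<A> \<subseteq> nsets {2..n} (k - 1)" "\<B> \<subseteq> nsets {2..n} k" "cross_intersecting \<A> \<B>"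
      "card \<B> = diversity n \<F>" "card \<F> = card \<A> + card \<B>"
      using intersecting_cross_intersecting[of \<F> n k] F n by auto
    show "card \<F> \<le> card (lex_family n (S l) (k - 1)) + card (lex_family n (T l) k)"
      unfolding AB(5) using cross[OF l AB(1-3)] F AB(4) by simp
  qed
qed

end
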